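(* Consider an acyclic network with $L$ links and $K$ classes. For each integer $\beta\ge1$ let $(N_\beta(t))$ be the scaled Markov process with initial state $N_\beta(0)\in\mathbb{N}^K$. If $$\lim_{\beta\to\infty}\frac1\beta\,a\odot N_\beta(0)=\bar X(0)\in\mathbb{R}_+^K,$$ then $(\beta^{-1}a\odot N_\beta(t))$ converges in probability, uniformly on compact sets of times, to the deterministic function $(\bar X(t))$ with initial value $\bar X(0)$ satisfying $$\dot{\bar X}_k(t)=a_k\lambda_k-a_k\mu_k\,\psi_k(\bar X(t)),\qquad 1\le k\le K,\ t\ge0.$$ That is, for all $T>0$ and $\varepsilon>0$, $\lim_{\beta\to\infty}\mathbb{P}\big(\sup_{0\le t\le T}\|\beta^{-1}a\odot N_\beta(t)-\bar X(t)\|_\infty\ge\varepsilon\big)=0$.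
   Context: $\odot$ denotes the componentwise product of vectors. Network: there are $L$ links, link $l$ having capacity $C_l>0$, and $K$ classes of flows. Class $k$ has arrival rate $\lambda_k>0$, inverse mean flow size $\mu_k>0$, access rate $a_k>0$, and a route $r_k=(r_k(1),\dots,r_k(d_k))$ which is an ordered sequence of $d_k$ distinct links. The network is acyclic if the links can be numbered so that each route is an increasing sequence of link indices. Tail-dropping allocation: for $x\in\mathbb{R}_+^K$ (input rates), put $\theta_k^0(x)=x_k$ and, for $1\le i\le d_k$ with $l=r_k(i)$, $$\theta_k^i(x)=\theta_k^{i-1}(x)\min\Big(\frac{C_l}{R_l(x)},1\Big),\qquad R_l(x)=\sum_{(k',i'):\,r_{k'}(i')=l}\theta_{k'}^{i'-1}(x)$$ (the minimum is $1$ if $R_l(x)=0$). In an acyclic network this defines the $\theta_k^i$ uniquely, processing links in increasing order. The throughput of class $k$ is $\psi_k(x)=\theta_k^{d_k}(x)$. Scaled process: access rates $a_k$ are replaced by $a_k/\beta$, arrival rates $\lambda_k$ by $\beta\lambda_k$ and inverse mean sizes $\mu_k$ by $\beta\mu_k$. Thus $(N_\beta(t))$ is the Markov jump process on $\mathbb{N}^K$ with transitions $n\to n+e_k$ at rate $\beta\lambda_k$ and $n\to n-e_k$ at rate $\beta\mu_k\psi_k(\beta^{-1}a\odot n)$, $1\le k\le K$ ($e_k$ is the unit vector of coordinate $k$). *)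

theory Defs
  imports "HOL-Probability.Probability"
begin

section \<open>Tail-dropping bandwidth allocation\<close>

text \<open>
  Classes are the elements of a finite type \<open>'k\<close>, links those of a finite type \<open>'l\<close>, and
  \<open>r k ! i\<close> (with \<open>i\<close> counted from 0) is the link number \<open>i + 1\<close> on the route of class \<open>k\<close>.
  Vectors of type \<open>real ^ 'k\<close> are multiplied componentwise by the library's \<open>(*)\<close>.
\<close>

definition acyclic_routes :: "('k \<Rightarrow> 'l::finite list) \<Rightarrow> bool" where
  "acyclic_routes r \<longleftrightarrow>
     (\<exists>num. bij_betw num (UNIV :: 'l set) {1..CARD('l)} \<and> (\<forall>k. sorted_wrt (<) (map num (r k))))"

definition link_load :: "('k::finite \<Rightarrow> 'l list) \<Rightarrow> ('k \<Rightarrow> nat \<Rightarrow> real) \<Rightarrow> 'l \<Rightarrow> real" where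
  "link_load r \<theta> l = (\<Sum>(k, i) \<in> {(k, i). i < length (r k) \<and> r k ! i = l}. \<theta> k i)"

definition pass_fraction :: "real \<Rightarrow> real \<Rightarrow> real" where
  "pass_fraction c R = (if R = 0 then 1 else min (c / R) 1)"

text \<open>\<open>\<theta> k i\<close> is the rate of class \<open>k\<close> after \<open>i\<close> links; the last clause only fixes the
  irrelevant values beyond the end of the route, so that \<open>\<theta>\<close> is unique as a function.\<close>

definition tail_dropping ::
  "real ^ 'l \<Rightarrow> ('k::finite \<Rightarrow> 'l list) \<Rightarrow> real ^ 'k \<Rightarrow> ('k \<Rightarrow> nat \<Rightarrow> real) \<Rightarrow> bool" where
  "tail_dropping C r x \<theta> \<longleftrightarrow>
     (\<forall>k. \<theta> k 0 = x $ k) \<and>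
     (\<forall>k. \<forall>i < length (r k).
        \<theta> k (Suc i) = \<theta> k i * pass_fraction (C $ (r k ! i)) (link_load r \<theta> (r k ! i))) \<and>
     (\<forall>k. \<forall>i > length (r k). \<theta> k i = 0)"

definition throughput :: "real ^ 'l \<Rightarrow> ('k::finite \<Rightarrow> 'l list) \<Rightarrow> real ^ 'k \<Rightarrow> real ^ 'k" where
  "throughput C r x = (\<chi> k. (THE \<theta>. tail_dropping C r x \<theta>) k (length (r k)))"

text \<open>The description in the definition of \<open>throughput\<close> is proper for acyclic networks.\<close>

lemma ex1_tail_dropping:
  fixes C :: "real ^ 'l::finite" and r :: "'k::finite \<Rightarrow> 'l list"
  assumes "acyclic_routes r"
  shows "\<exists>!\<theta>. tail_dropping C r x \<theta>"
proof -
  obtain num :: "'l \<Rightarrow> nat" where num: "\<And>k. sorted_wrt (<) (map num (r k))"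
    using assms unfolding acyclic_routes_def by blast
  define F :: "('k \<Rightarrow> nat \<Rightarrow> real) \<Rightarrow> 'k \<Rightarrow> nat \<Rightarrow> real" where
    "F \<theta> k i = (case i of 0 \<Rightarrow> x $ k
       | Suc j \<Rightarrow> if j < length (r k)
           then \<theta> k j * pass_fraction (C $ (r k ! j)) (link_load r \<theta> (r k ! j)) else 0)" for \<theta> k i
  have fixp: "tail_dropping C r x \<theta> \<longleftrightarrow> (\<forall>k i. \<theta> k i = F \<theta> k i)" for \<theta>
  proof
    assume t: "tail_dropping C r x \<theta>"
    have "\<theta> k i = F \<theta> k i" for k i
      using t by (cases i) (auto simp: tail_dropping_def F_def)
    then show "\<forall>k i. \<theta> k i = F \<theta> k i" by blast
  next
    assume e: "\<forall>k i. \<theta> k i = F \<theta> k i"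
    have "\<theta> k 0 = x $ k" for k
      using e[rule_format, of k 0] by (simp add: F_def)
    moreover have "\<theta> k (Suc i) = \<theta> k i * pass_fraction (C $ (r k ! i)) (link_load r \<theta> (r k ! i))"
      if "i < length (r k)" for k i
      using e[rule_format, of k "Suc i"] that by (simp add: F_def)
    moreover have "\<theta> k i = 0" if "i > length (r k)" for k i
      using e[rule_format, of k i] that by (cases i) (auto simp: F_def)
    ultimately show "tail_dropping C r x \<theta>"
      unfolding tail_dropping_def by blast
  qed
  define rk where "rk k i = (case i of 0 \<Rightarrow> 0
       | Suc j \<Rightarrow> if j < length (r k) then Suc (num (r k ! j)) else 0)" for k i
  have step: "F \<theta> k i = F \<theta>' k i"
    if agree: "\<And>k i. rk k i < n \<Longrightarrow> \<theta> k i = \<theta>' k i" and "rk k i < Suc n" for \<theta> \<theta>' n k i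
  proof (cases i)
    case 0
    then show ?thesis by (simp add: F_def)
  next
    case (Suc j)
    show ?thesis
    proof (cases "j < length (r k)")
      case False
      then show ?thesis using Suc by (simp add: F_def)
    next
      case True
      let ?l = "r k ! j"
      have n: "num ?l < n" using that(2) Suc True by (simp add: rk_def)
      have key: "\<theta> k' i' = \<theta>' k' i'" if "i' < length (r k')" "r k' ! i' = ?l" for k' i'
      proof (rule agree)
        show "rk k' i' < n"
        proof (cases i')
          case 0
          then show ?thesis using n by (simp add: rk_def)
        next
          case (Suc j')
          then have "num (r k' ! j') < num (r k' ! i')"
            using sorted_wrt_nth_less[OF num[of k'], of j' i'] that by simp
          then show ?thesis using Suc that n by (simp add: rk_def)
        qed
      qed
      have "link_load r \<theta> ?l = link_load r \<theta>' ?l"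
        unfolding link_load_def by (rule sum.cong) (auto simp: key)
      with key[OF True refl] show ?thesis using Suc True by (simp add: F_def)
    qed
  qed
  have uniq: "\<theta> k i = \<theta>' k i"
    if "tail_dropping C r x \<theta>" "tail_dropping C r x \<theta>'" "rk k i < n" for \<theta> \<theta>' n k i
    using that(3)
  proof (induction n arbitrary: k i)
    case (Suc n)
    have "F \<theta> k i = F \<theta>' k i"
      by (rule step[OF Suc.IH Suc.prems])
    moreover have "\<theta> k i = F \<theta> k i" "\<theta>' k i = F \<theta>' k i" using that(1,2) fixp by blast+
    ultimately show ?case by simp
  qed simp
  define G where "G n = (F ^^ n) (\<lambda>_ _. 0)" for n
  have G: "G (Suc n) k i = G n k i" if "rk k i < n" for n k i
    using that
  proof (induction n arbitrary: k i)
    case (Suc n)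
    have "F (G (Suc n)) k i = F (G n) k i"
      by (rule step[OF Suc.IH Suc.prems])
    then show ?case by (simp add: G_def)
  qed simp
  have G': "G m k i = G n k i" if "n \<le> m" "rk k i < n" for m n k i
    using that by (induction m rule: dec_induct) (auto simp: G)
  define \<theta> where "\<theta> k i = G (Suc (rk k i)) k i" for k i
  have "\<theta> k i = F \<theta> k i" for k i
  proof -
    have "F (G (rk k i)) k i = F \<theta> k i"
    proof (rule step)
      show "G (rk k i) k' i' = \<theta> k' i'" if "rk k' i' < rk k i" for k' i'
        unfolding \<theta>_def using G'[of "Suc (rk k' i')" "rk k i" k' i'] that by simp
    qed simp
    then show ?thesis by (simp add: \<theta>_def G_def)
  qed
  then have "tail_dropping C r x \<theta>" using fixp by blast
  then show ?thesis by (blast intro: uniq)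
qed

section \<open>Markov jump processes\<close>

text \<open>
  \<open>q i j\<close> is the rate of the transition from \<open>i\<close> to \<open>j\<close> for \<open>i \<noteq> j\<close>; the diagonal is ignored.
\<close>

definition exit_rate :: "('s \<Rightarrow> 's \<Rightarrow> real) \<Rightarrow> 's \<Rightarrow> real" where
  "exit_rate q i = (\<Sum>\<^sub>\<infinity>j\<in>-{i}. q i j)"

definition jump_prob :: "('s \<Rightarrow> 's \<Rightarrow> real) \<Rightarrow> 's \<Rightarrow> 's \<Rightarrow> real" where
  "jump_prob q i j = (if i = j then 0 else q i j / exit_rate q i)"

text \<open>
  Right-continuous process with jump chain \<open>Y\<close> and holding times \<open>S\<close>: \<open>Y\<close> is a Markov chain with
  transition matrix \<open>jump_prob q\<close> and, given \<open>Y\<close>, the \<open>S n\<close> are independent and exponential with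
  parameters \<open>exit_rate q (Y n)\<close>; the last conjunct states this through the joint law of
  \<open>Y 0, S 0, \<dots>, S (n - 1), Y n\<close>. The initial law is free. Paths are defined for all times, hence
  have finitely many jumps in bounded time. Absorbing states (exit rate 0) are not catered for.
\<close>

definition markov_jump_process ::
  "'w measure \<Rightarrow> ('s::countable \<Rightarrow> 's \<Rightarrow> real) \<Rightarrow> (real \<Rightarrow> 'w \<Rightarrow> 's) \<Rightarrow> bool" where
  "markov_jump_process M q N \<longleftrightarrow>
     prob_space M \<and>
     (\<exists>Y S.
        (\<forall>n::nat. Y n \<in> M \<rightarrow>\<^sub>M count_space UNIV) \<and>
        (\<forall>n. S n \<in> borel_measurable M) \<and>
        (\<forall>\<omega>\<in>space M. (\<forall>n. 0 < S n \<omega>) \<and>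
           filterlim (\<lambda>n. \<Sum>m<n. S m \<omega>) at_top sequentially \<and>
           (\<forall>n. \<forall>t. (\<Sum>m<n. S m \<omega>) \<le> t \<and> t < (\<Sum>m<Suc n. S m \<omega>) \<longrightarrow> N t \<omega> = Y n \<omega>)) \<and>
        (\<forall>n y s. (\<forall>m<n. 0 \<le> s m) \<longrightarrow>
           measure M {\<omega>\<in>space M. (\<forall>m\<le>n. Y m \<omega> = y m) \<and> (\<forall>m<n. s m < S m \<omega>)} =
           measure M {\<omega>\<in>space M. Y 0 \<omega> = y 0} *
             (\<Prod>m<n. jump_prob q (y m) (y (Suc m)) * exp (- exit_rate q (y m) * s m))))"

section \<open>The flow-level process and its fluid limit\<close>

definition real_vec :: "nat ^ 'k \<Rightarrow> real ^ 'k" where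
  "real_vec n = (\<chi> k. real (n $ k))"

text \<open>
  If \<open>n $ k = 0\<close>, the truncated difference \<open>n - axis k 1\<close> is \<open>n\<close> itself, so the second sum then
  contributes no transition (in agreement with the rate 0 of the departures).
\<close>

definition flow_rates ::
  "real ^ 'l \<Rightarrow> ('k::finite \<Rightarrow> 'l list) \<Rightarrow> real ^ 'k \<Rightarrow> real ^ 'k \<Rightarrow> real ^ 'k \<Rightarrow>
     nat ^ 'k \<Rightarrow> nat ^ 'k \<Rightarrow> real" where
  "flow_rates C r lam \<mu> a n m =
     (\<Sum>k\<in>UNIV. if m = n + axis k 1 then lam $ k else 0) +
     (\<Sum>k\<in>UNIV. if m = n - axis k 1 then \<mu> $ k * throughput C r (a * real_vec n) $ k else 0)"

definition scaled_flow_rates ::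
  "real ^ 'l \<Rightarrow> ('k::finite \<Rightarrow> 'l list) \<Rightarrow> real ^ 'k \<Rightarrow> real ^ 'k \<Rightarrow> real ^ 'k \<Rightarrow> nat \<Rightarrow>
     nat ^ 'k \<Rightarrow> nat ^ 'k \<Rightarrow> real" where
  "scaled_flow_rates C r lam \<mu> a \<beta> =
     flow_rates C r (real \<beta> *\<^sub>R lam) (real \<beta> *\<^sub>R \<mu>) ((1 / real \<beta>) *\<^sub>R a)"

definition fluid_solution ::
  "real ^ 'l \<Rightarrow> ('k::finite \<Rightarrow> 'l list) \<Rightarrow> real ^ 'k \<Rightarrow> real ^ 'k \<Rightarrow> real ^ 'k \<Rightarrow> real ^ 'k \<Rightarrow>
     (real \<Rightarrow> real ^ 'k) \<Rightarrow> bool" where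
  "fluid_solution C r lam \<mu> a x0 X \<longleftrightarrow>
     X 0 = x0 \<and>
     (\<forall>t\<ge>0. \<forall>k. 0 \<le> X t $ k) \<and>
     (\<forall>t\<ge>0. \<forall>k. ((\<lambda>s. X s $ k) has_real_derivative
        (a $ k * lam $ k - a $ k * \<mu> $ k * throughput C r (X t) $ k)) (at t within {0..}))"

definition sup_deviation ::
  "real ^ 'k::finite \<Rightarrow> nat \<Rightarrow> (real \<Rightarrow> 'w \<Rightarrow> nat ^ 'k) \<Rightarrow> (real \<Rightarrow> real ^ 'k) \<Rightarrow> real \<Rightarrow>
     'w \<Rightarrow> real" where
  "sup_deviation a \<beta> N X T \<omega> =
     (SUP t\<in>{0..T}. infnorm ((1 / real \<beta>) *\<^sub>R (a * real_vec (N t \<omega>)) - X t))"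

end

theory Submission
  imports Defs
begin

text \<open>
  Let \<open>Z\<^sub>0, Z\<^sub>1, \<dots>\<close> be the states of the scaled process between its jumps, expressed as input rates
  \<open>\<beta>\<^sup>-\<^sup>1 a \<odot> n\<close>, and let \<open>\<theta>\<^sub>m\<close> be the mean time that it stays in \<open>Z\<^sub>m\<close>. Given \<open>Z\<^sub>m\<close>, the next jump has mean
  \<open>\<theta>\<^sub>m drift Z\<^sub>m\<close>, where \<open>drift\<close> is the right-hand side of the fluid equation. So \<open>Z\<close> is an Euler scheme
  with step lengths \<open>\<theta>\<^sub>m\<close>, perturbed by a martingale \<open>V\<close> with increments of order \<open>1 / \<beta>\<close>. Only of the
  order of \<open>\<beta>\<close> jumps matter, and after so many jumps the variance of \<open>V\<close> is of order \<open>1 / \<beta>\<close>.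

  This scheme runs on the clock \<open>\<Theta>\<^sub>n = \<theta>\<^sub>0 + \<dots> + \<theta>\<^sub>n\<^sub>-\<^sub>1\<close> instead of the true jump times \<open>T\<^sub>n\<close>. Given the
  jump chain, the holding times are independent and exponential, with means of at most a constant
  over \<open>\<beta>\<close> since arrivals alone occur at a rate proportional to \<open>\<beta>\<close>. Hence the variance of
  \<open>T\<^sub>n - \<Theta>\<^sub>n\<close> is of order \<open>1 / \<beta>\<close> as well. Separating the two sources of randomness has the advantage
  that both martingales have second moments that are bounded by elementary means, whatever region
  the process visits (\<open>chain_second_moment\<close>, \<open>clock_second_moment\<close>).

  These bounds hold uniformly in time, because both \<open>V\<close> and \<open>T - \<Theta>\<close> fall by at most a constant over \<open>\<beta>\<close>
  in a step. Such a sequence is small everywhere if it is small on a sufficiently fine grid, and a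
  grid with a bounded number of points is fine enough, so that Chebyshev's inequality at these
  points gives the claim (\<open>prob_max_le\<close>, \<open>prob_max_tendsto_0\<close>).

  The rest is deterministic (\<open>jump_path_near_solution\<close>). The drift is globally Lipschitz on the
  nonnegative orthant, because the rate \<open>\<theta> min (C / R) 1\<close> behind a link is a Lipschitz function of the
  rate \<open>\<theta>\<close> and the load \<open>R\<close> in front of it, as long as \<open>0 \<le> \<theta> \<le> R\<close> (\<open>throughput_Lipschitz\<close>). So the
  fluid equation has exactly one solution (\<open>fluid_solution_exists\<close>, \<open>fluid_solution_unique\<close>), and
  Gronwall's inequality keeps the perturbed Euler scheme close to it. Throughputs may be unbounded
  if a route is empty, but near the solution the total jump rate is at most a constant times
  \<open>\<beta>\<close>, and this is where the scheme stays.
\<close>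

section \<open>Lipschitz continuity of the throughput\<close>

text \<open>The rate of a class behind a link depends on the rates of all the classes in front of this
  link. In an acyclic network this dependence is well-founded: the induction runs over the number
  of the link that is passed last.\<close>

lemma route_induct [consumes 2, case_names source link]:
  fixes r :: "'k::finite \<Rightarrow> 'l::finite list"
  assumes acyc: "acyclic_routes r" and "i \<le> length (r k)"
    and source: "\<And>k. P k 0"
    and link: "\<And>k i. i < length (r k) \<Longrightarrow>
       (\<And>k' i'. i' < length (r k') \<Longrightarrow> r k' ! i' = r k ! i \<Longrightarrow> P k' i') \<Longrightarrow> P k (Suc i)"
  shows "P k i"
proof -
  obtain num :: "'l \<Rightarrow> nat" where num: "\<And>k. sorted_wrt (<) (map num (r k))"
    using acyc unfolding acyclic_routes_def by blast
  define rank where "rank k i = (case i of 0 \<Rightarrow> 0 | Suc j \<Rightarrow> Suc (num (r k ! j)))" for k i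
  from \<open>i \<le> length (r k)\<close> show ?thesis
  proof (induction "rank k i" arbitrary: k i rule: less_induct)
    case less
    show ?case
    proof (cases i)
      case 0
      then show ?thesis by (simp add: source)
    next
      case (Suc j)
      have "P k (Suc j)"
      proof (rule link)
        show "j < length (r k)" using less.prems Suc by simp
        fix k' i' assume i': "i' < length (r k')" "r k' ! i' = r k ! j"
        have "rank k' i' < rank k i"
        proof (cases i')
          case (Suc j')
          then have "num (r k' ! j') < num (r k' ! i')"
            using sorted_wrt_nth_less[OF num[of k'], of j' i'] i' by simp
          then show ?thesis using Suc i' \<open>i = Suc j\<close> by (simp add: rank_def)
        qed (simp add: rank_def \<open>i = Suc j\<close>)
        then show "P k' i'" using less.hyps i' by simp
      qed
      then show ?thesis using Suc by simp
    qed
  qed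
qed

lemma pass_fraction_bounds:
  assumes "0 < c" "0 \<le> R"
  shows "0 \<le> pass_fraction c R" "pass_fraction c R \<le> 1"
  using assms by (auto simp: pass_fraction_def)

lemma pass_fraction_times_load:
  assumes "0 < c" "0 \<le> R"
  shows "R * pass_fraction c R = min c R"
  using assms by (auto simp: pass_fraction_def min_def field_simps)

text \<open>The difference of the two fractions is multiplied by a rate \<open>t'\<close> that may be arbitrarily large.
  As \<open>t' \<le> R'\<close>, it suffices to bound the difference of the fractions times \<open>R'\<close>, and a load times
  its own fraction is the Lipschitz function \<open>min c\<close>. The constants do not depend on \<open>c\<close>.\<close>

lemma passing_rate_Lipschitz:
  assumes "0 < c" "0 \<le> t" "t \<le> R" "0 \<le> t'" "t' \<le> R'"
  shows "\<bar>t * pass_fraction c R - t' * pass_fraction c R'\<bar> \<le> \<bar>t - t'\<bar> + 2 * \<bar>R - R'\<bar>"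
proof -
  let ?p = "pass_fraction c R" and ?q = "pass_fraction c R'"
  have pq: "0 \<le> ?p" "?p \<le> 1" using pass_fraction_bounds assms by auto
  have eq: "R' * (?p - ?q) = (R' - R) * ?p + (min c R - min c R')"
    using pass_fraction_times_load[of c R] pass_fraction_times_load[of c R'] assms
    by (simp add: algebra_simps)
  have "t' * \<bar>?p - ?q\<bar> \<le> R' * \<bar>?p - ?q\<bar>"
    using assms by (intro mult_right_mono) auto
  also have "\<dots> = \<bar>R' * (?p - ?q)\<bar>" using assms by (simp add: abs_mult)
  also have "\<dots> \<le> \<bar>(R' - R) * ?p\<bar> + \<bar>min c R - min c R'\<bar>"
    unfolding eq by (rule abs_triangle_ineq)
  also have "\<bar>(R' - R) * ?p\<bar> \<le> \<bar>R - R'\<bar>"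
    using pq by (simp add: abs_mult mult_left_le abs_minus_commute)
  also have "\<bar>min c R - min c R'\<bar> \<le> \<bar>R - R'\<bar>" by (auto simp: min_def)
  finally have 1: "t' * \<bar>?p - ?q\<bar> \<le> 2 * \<bar>R - R'\<bar>" by simp
  have "\<bar>t * ?p - t' * ?q\<bar> = \<bar>(t - t') * ?p + t' * (?p - ?q)\<bar>" by (simp add: algebra_simps)
  also have "\<dots> \<le> \<bar>(t - t') * ?p\<bar> + \<bar>t' * (?p - ?q)\<bar>" by (rule abs_triangle_ineq)
  also have "\<bar>(t - t') * ?p\<bar> \<le> \<bar>t - t'\<bar>" using pq by (simp add: abs_mult mult_left_le)
  also have "\<bar>t' * (?p - ?q)\<bar> = t' * \<bar>?p - ?q\<bar>" using assms by (simp add: abs_mult)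
  finally show ?thesis using 1 by simp
qed

lemma finite_link_inputs: "finite {(k::'k::finite, i). i < length (r k) \<and> r k ! i = l}"
proof (rule finite_subset)
  show "{(k, i). i < length (r k) \<and> r k ! i = l} \<subseteq> (SIGMA k:UNIV. {..<length (r k)})" by auto
qed simp

lemma rate_le_link_load:
  fixes r :: "'k::finite \<Rightarrow> 'l list"
  assumes "\<And>k i. i < length (r k) \<Longrightarrow> r k ! i = l \<Longrightarrow> 0 \<le> \<theta> k i"
    and "i < length (r k)" "r k ! i = l"
  shows "\<theta> k i \<le> link_load r \<theta> l"
proof -
  have "(case (k, i) of (k, i) \<Rightarrow> \<theta> k i) \<le> link_load r \<theta> l"
    unfolding link_load_def
    by (rule member_le_sum) (use assms finite_link_inputs[of r l] in auto)
  then show ?thesis by simp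
qed

lemma link_load_nonneg:
  assumes "\<And>k i. i < length (r k) \<Longrightarrow> r k ! i = l \<Longrightarrow> 0 \<le> \<theta> k i"
  shows "0 \<le> link_load r \<theta> l"
  unfolding link_load_def by (rule sum_nonneg) (use assms in auto)

context
  fixes C :: "real ^ 'l::finite" and r :: "'k::finite \<Rightarrow> 'l list"
  assumes acyc: "acyclic_routes r" and C_pos: "\<And>l. 0 < C $ l"
begin

definition rates_along :: "real ^ 'k \<Rightarrow> 'k \<Rightarrow> nat \<Rightarrow> real" where
  "rates_along x = (THE \<theta>. tail_dropping C r x \<theta>)"

lemma tail_dropping_rates_along: "tail_dropping C r x (rates_along x)"
  unfolding rates_along_def by (rule theI'[OF ex1_tail_dropping[OF acyc]])

lemma rates_along_0: "rates_along x k 0 = x $ k"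
  and rates_along_Suc: "i < length (r k) \<Longrightarrow> rates_along x k (Suc i) =
    rates_along x k i * pass_fraction (C $ (r k ! i)) (link_load r (rates_along x) (r k ! i))"
  using tail_dropping_rates_along[of x] by (auto simp: tail_dropping_def)

lemma throughput_eq: "throughput C r x $ k = rates_along x k (length (r k))"
  by (simp add: throughput_def rates_along_def)

text \<open>Nonnegativity is not clear from the recursion along a single route, because a negative load
  would make the fraction negative; it has to be proved for all the classes at a link together.\<close>

lemma rates_along_nonneg:
  assumes x: "\<And>k. 0 \<le> x $ k" and "i \<le> length (r k)"
  shows "0 \<le> rates_along x k i"
  using acyc \<open>i \<le> length (r k)\<close>
proof (induction rule: route_induct)
  case (link k i)
  then have "0 \<le> link_load r (rates_along x) (r k ! i)" by (intro link_load_nonneg) auto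
  then show ?case
    using link pass_fraction_bounds(1)[OF C_pos] by (simp add: rates_along_Suc)
qed (simp add: rates_along_0 x)

lemma rates_along_le:
  assumes x: "\<And>k. 0 \<le> x $ k" and "i \<le> length (r k)"
  shows "rates_along x k i \<le> x $ k"
  using assms(2)
proof (induction i)
  case (Suc i)
  then have i: "i < length (r k)" by simp
  have "0 \<le> link_load r (rates_along x) (r k ! i)"
    using rates_along_nonneg[OF x] by (intro link_load_nonneg) auto
  then have "rates_along x k (Suc i) \<le> rates_along x k i * 1"
    unfolding rates_along_Suc[OF i]
    using pass_fraction_bounds(2)[OF C_pos] rates_along_nonneg[OF x, of i k] i
    by (intro mult_left_mono) auto
  then show ?case using Suc by simp
qed (simp add: rates_along_0)

lemma rates_along_Lipschitz:
  assumes "i \<le> length (r k)"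
  shows "\<exists>L. L-lipschitz_on {x. \<forall>k. 0 \<le> x $ k} (\<lambda>x. rates_along x k i)"
  using acyc assms
proof (induction rule: route_induct)
  case (source k)
  have "1-lipschitz_on {x. \<forall>k. 0 \<le> x $ k} (\<lambda>x::real ^ 'k. x $ k)"
    by (rule lipschitz_onI) (auto simp: dist_vec_nth_le)
  then show ?case by (auto simp: rates_along_0)
next
  case (link k i)
  let ?l = "r k ! i" and ?I = "{(k', i'). i' < length (r k') \<and> r k' ! i' = r k ! i}"
  let ?O = "{x::real ^ 'k. \<forall>k. 0 \<le> x $ k}"
  have "\<forall>z\<in>?I. \<exists>L. L-lipschitz_on ?O (\<lambda>x. rates_along x (fst z) (snd z))"
    using link.IH by auto
  from bchoice[OF this] obtain Lf where
    Lf: "\<And>z. z \<in> ?I \<Longrightarrow> (Lf z)-lipschitz_on ?O (\<lambda>x. rates_along x (fst z) (snd z))" by blast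
  define D where "D = (\<Sum>z\<in>?I. Lf z)"
  have load: "\<bar>link_load r (rates_along x) ?l - link_load r (rates_along y) ?l\<bar> \<le> D * dist x y"
    if "x \<in> ?O" "y \<in> ?O" for x y
  proof -
    have "link_load r (rates_along x) ?l - link_load r (rates_along y) ?l =
       (\<Sum>z\<in>?I. rates_along x (fst z) (snd z) - rates_along y (fst z) (snd z))"
      unfolding link_load_def by (simp only: sum_subtractf case_prod_unfold)
    also have "\<bar>\<dots>\<bar> \<le> (\<Sum>z\<in>?I. Lf z * dist x y)"
    proof (rule order_trans[OF sum_abs], rule sum_mono)
      fix z assume "z \<in> ?I"
      from lipschitz_onD[OF Lf[OF this] that]
      show "\<bar>rates_along x (fst z) (snd z) - rates_along y (fst z) (snd z)\<bar> \<le> Lf z * dist x y"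
        by (simp add: dist_real_def)
    qed
    also have "\<dots> = D * dist x y" by (simp only: D_def sum_distrib_right)
    finally show ?thesis .
  qed
  have mem: "(k, i) \<in> ?I" using link.hyps by simp
  have "(Lf (k, i) + 2 * D)-lipschitz_on ?O (\<lambda>x. rates_along x k (Suc i))"
  proof (rule lipschitz_onI)
    show "0 \<le> Lf (k, i) + 2 * D"
      unfolding D_def
      by (intro add_nonneg_nonneg mult_nonneg_nonneg sum_nonneg lipschitz_on_nonneg[OF Lf] mem) auto
    fix x y assume xy: "x \<in> ?O" "y \<in> ?O"
    have n: "0 \<le> rates_along z k' i'" if "z \<in> ?O" "i' < length (r k')" for z k' i'
      using rates_along_nonneg[of z i' k'] that by simp
    have le: "rates_along z k i \<le> link_load r (rates_along z) ?l" if "z \<in> ?O" for z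
      by (rule rate_le_link_load) (use link.hyps n[OF that] in auto)
    have "\<bar>rates_along x k (Suc i) - rates_along y k (Suc i)\<bar> \<le>
      \<bar>rates_along x k i - rates_along y k i\<bar> +
      2 * \<bar>link_load r (rates_along x) ?l - link_load r (rates_along y) ?l\<bar>"
      unfolding rates_along_Suc[OF link.hyps]
      by (rule passing_rate_Lipschitz) (use link.hyps n le C_pos xy in simp_all)
    also have "\<dots> \<le> Lf (k, i) * dist x y + 2 * (D * dist x y)"
      using lipschitz_onD[OF Lf[OF mem] xy] load[OF xy] by (simp add: dist_real_def)
    finally show "dist (rates_along x k (Suc i)) (rates_along y k (Suc i)) \<le>
        (Lf (k, i) + 2 * D) * dist x y"
      by (simp add: algebra_simps dist_real_def)
  qed
  then show ?case by blast
qed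

lemma throughput_nonneg: "(\<And>k. 0 \<le> x $ k) \<Longrightarrow> 0 \<le> throughput C r x $ k"
  by (simp add: throughput_eq rates_along_nonneg)

lemma throughput_le: "(\<And>k. 0 \<le> x $ k) \<Longrightarrow> throughput C r x $ k \<le> x $ k"
  by (simp add: throughput_eq rates_along_le)

lemma throughput_Lipschitz: "\<exists>L. L-lipschitz_on {x. \<forall>k. 0 \<le> x $ k} (throughput C r)"
proof -
  have "\<forall>k. \<exists>L. L-lipschitz_on {x. \<forall>k. 0 \<le> x $ k} (\<lambda>x. throughput C r x $ k)"
    unfolding throughput_eq using rates_along_Lipschitz by blast
  then obtain Lf where
    Lf: "\<And>k. (Lf k)-lipschitz_on {x. \<forall>k. 0 \<le> x $ k} (\<lambda>x. throughput C r x $ k)"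
    by metis
  have "(\<Sum>k\<in>UNIV. Lf k)-lipschitz_on {x. \<forall>k. 0 \<le> x $ k} (throughput C r)"
  proof (rule lipschitz_onI)
    show "0 \<le> (\<Sum>k\<in>UNIV. Lf k)" using lipschitz_on_nonneg[OF Lf] by (simp add: sum_nonneg)
    fix x y :: "real ^ 'k" assume xy: "x \<in> {x. \<forall>k. 0 \<le> x $ k}" "y \<in> {x. \<forall>k. 0 \<le> x $ k}"
    have "dist (throughput C r x) (throughput C r y) \<le>
        (\<Sum>k\<in>UNIV. \<bar>(throughput C r x - throughput C r y) $ k\<bar>)"
      unfolding dist_norm by (rule norm_le_l1_cart)
    also have "\<dots> \<le> (\<Sum>k\<in>UNIV. Lf k * dist x y)"
      using lipschitz_onD[OF Lf xy] by (intro sum_mono) (simp add: dist_real_def)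
    finally show "dist (throughput C r x) (throughput C r y) \<le> (\<Sum>k\<in>UNIV. Lf k) * dist x y"
      by (simp add: sum_distrib_right)
  qed
  then show ?thesis by blast
qed

end

section \<open>Ordinary differential equations with a Lipschitz right-hand side\<close>

lemma norm_integral_exp_bound:
  fixes f :: "real \<Rightarrow> 'a::euclidean_space"
  assumes "0 < c" "0 \<le> s" "continuous_on {0..s} f"
    and "\<And>u. u \<in> {0..s} \<Longrightarrow> norm (f u) \<le> K * exp (c * u)"
  shows "norm (integral {0..s} f) \<le> K / c * (exp (c * s) - 1)"
proof -
  have "((\<lambda>u. K / c * exp (c * u)) has_vector_derivative K * exp (c * x)) (at x within {0..s})" for x
    using \<open>0 < c\<close> by (auto intro!: derivative_eq_intros simp flip: has_real_derivative_iff_has_vector_derivative)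
  then have I: "((\<lambda>u. K * exp (c * u)) has_integral K / c * exp (c * s) - K / c * exp (c * 0)) {0..s}"
    by (intro fundamental_theorem_of_calculus) (use assms in auto)
  have "norm (integral {0..s} f) \<le> integral {0..s} (\<lambda>u. K * exp (c * u))"
    using assms I by (intro integral_norm_bound_integral) (auto intro: integrable_continuous_real)
  also have "\<dots> = K / c * (exp (c * s) - 1)"
    using integral_unique[OF I] by (simp add: algebra_simps)
  finally show ?thesis .
qed

text \<open>Global existence on the half-line in one application of Banach's fixed point theorem. In the
  sup norm, the Picard operator only contracts on short time intervals; for functions weighted by
  \<open>exp (- c t)\<close> with \<open>c = 2 (L + 1)\<close> it contracts with the constant 1/2 on the whole half-line. The
  fixed point \<open>g\<close> below is the weighted solution \<open>exp (- c t) X t\<close>, continued as a constant to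
  negative times.\<close>

lemma global_solution_exists:
  fixes F :: "'a::euclidean_space \<Rightarrow> 'a"
  assumes Lip: "L-lipschitz_on UNIV F"
  shows "\<exists>X. X 0 = x0 \<and> (\<forall>t\<ge>0. (X has_vector_derivative F (X t)) (at t within {0..}))"
proof -
  define K where "K = L + 1"
  define c where "c = 2 * K"
  have "0 \<le> L" using lipschitz_on_nonneg[OF Lip] .
  then have K: "0 < K" and c: "0 < c" and Kc: "K / c = 1 / 2" by (auto simp: K_def c_def)
  have F: "norm (F x - F y) \<le> K * norm (x - y)" for x y
  proof -
    have "norm (F x - F y) \<le> L * norm (x - y)" using lipschitz_on_normD[OF Lip] by simp
    also have "\<dots> \<le> K * norm (x - y)" by (intro mult_right_mono) (auto simp: K_def)
    finally show ?thesis .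
  qed
  have Fcont: "continuous_on A F" for A
    using lipschitz_on_continuous_on[OF Lip] continuous_on_subset by blast
  define f where "f g u = F (exp (c * u) *\<^sub>R apply_bcontfun g u)" for g u
  have fcont: "continuous_on A (f g)" for A g
    unfolding f_def by (intro continuous_on_compose2[OF Fcont[of UNIV]] continuous_intros) auto
  define I where "I g s = x0 + integral {0..s} (f g)" for g s
  have Ideriv: "(I g has_vector_derivative f g t) (at t within {0..})" if "0 \<le> t" for g t
  proof -
    have "((\<lambda>s. integral {0..s} (f g)) has_vector_derivative f g t) (at t within {0..t + 1})"
      by (rule integral_has_vector_derivative[OF fcont]) (use that in auto)
    moreover have "at t within {0..t + 1} = at t within {0..}"
      by (rule at_within_nhd[of _ "{..<t + 1}"]) auto
    ultimately show ?thesis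
      unfolding I_def by (auto intro!: derivative_eq_intros)
  qed
  have Icont: "continuous_on {0..} (I g)" for g
    using has_vector_derivative_continuous[OF Ideriv]
    by (simp add: continuous_on_eq_continuous_within)
  have clamp: "continuous_on UNIV (\<lambda>t. max 0 t :: real)"
    by (intro continuous_intros)
  define P where "P g t = exp (- c * max 0 t) *\<^sub>R I g (max 0 t)" for g t
  have Pcont: "continuous_on UNIV (P g)" for g
    unfolding P_def
    by (intro continuous_intros clamp continuous_on_compose2[OF Icont clamp]) auto
  have Pbound: "norm (P g t) \<le> norm x0 + (norm (F 0) + K * norm g) / c" for g t
  proof -
    define s where "s = max 0 t"
    have s: "0 \<le> s" by (simp add: s_def)
    have "norm (integral {0..s} (f g)) \<le> (norm (F 0) + K * norm g) / c * (exp (c * s) - 1)"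
    proof (rule norm_integral_exp_bound[OF c s fcont])
      fix u assume "u \<in> {0..s}"
      then have e: "1 \<le> exp (c * u)" using c by simp
      have "norm (f g u) \<le> norm (F 0) + norm (f g u - F 0)" by (rule norm_triangle_sub)
      also have "norm (f g u - F 0) \<le> K * (exp (c * u) * norm (apply_bcontfun g u))"
        unfolding f_def using F[of "exp (c * u) *\<^sub>R apply_bcontfun g u" 0] by simp
      also have "\<dots> \<le> K * (exp (c * u) * norm g)"
        using K by (intro mult_left_mono norm_bounded) auto
      also have "norm (F 0) \<le> norm (F 0) * exp (c * u)"
        using e by (simp add: mult_le_cancel_left1)
      finally show "norm (f g u) \<le> (norm (F 0) + K * norm g) * exp (c * u)"
        by (simp add: algebra_simps)
    qed
    also have "\<dots> \<le> (norm (F 0) + K * norm g) / c * exp (c * s)"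
      using c K by (intro mult_left_mono) auto
    finally have "norm (I g s) \<le> norm x0 + (norm (F 0) + K * norm g) / c * exp (c * s)"
      unfolding I_def by (intro norm_triangle_le) simp
    then have "norm (P g t) \<le> exp (- c * s) * (norm x0 + (norm (F 0) + K * norm g) / c * exp (c * s))"
      unfolding P_def s_def[symmetric] by simp
    also have "\<dots> = exp (- c * s) * norm x0 + (norm (F 0) + K * norm g) / c"
      by (simp add: algebra_simps flip: exp_add)
    also have "exp (- c * s) * norm x0 \<le> norm x0"
      using c s by (simp add: mult_left_le_one_le)
    finally show ?thesis by simp
  qed
  have Pbcont: "P g \<in> bcontfun" for g
    by (rule bcontfun_normI[OF Pcont Pbound])
  define \<Phi> where "\<Phi> g = Bcontfun (P g)" for g
  have \<Phi>: "apply_bcontfun (\<Phi> g) = P g" for g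
    unfolding \<Phi>_def using Pbcont by (simp add: Bcontfun_inverse)
  have "dist (\<Phi> g) (\<Phi> h) \<le> 1 / 2 * dist g h" for g h
  proof (rule dist_bound)
    fix t :: real
    define s where "s = max 0 t"
    have s: "0 \<le> s" by (simp add: s_def)
    have int: "f g integrable_on {0..s}" for g
      by (intro integrable_continuous_real fcont)
    have "norm (integral {0..s} (\<lambda>u. f g u - f h u)) \<le> (K * dist g h) / c * (exp (c * s) - 1)"
    proof (rule norm_integral_exp_bound[OF c s])
      fix u
      have "norm (f g u - f h u) \<le>
          K * norm (exp (c * u) *\<^sub>R apply_bcontfun g u - exp (c * u) *\<^sub>R apply_bcontfun h u)"
        unfolding f_def by (rule F)
      also have "\<dots> = K * (exp (c * u) * dist (apply_bcontfun g u) (apply_bcontfun h u))"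
        by (simp add: dist_norm flip: scaleR_diff_right)
      also have "\<dots> \<le> K * (exp (c * u) * dist g h)"
        using K by (intro mult_left_mono dist_bounded) auto
      finally show "norm (f g u - f h u) \<le> K * dist g h * exp (c * u)" by (simp add: algebra_simps)
    qed (intro continuous_intros fcont)
    also have "\<dots> \<le> (K * dist g h) / c * exp (c * s)"
      using c K by (intro mult_left_mono) auto
    also have "\<dots> = 1 / 2 * dist g h * exp (c * s)" using Kc by simp
    also have "integral {0..s} (\<lambda>u. f g u - f h u) = I g s - I h s"
      unfolding I_def using int by (simp add: integral_diff)
    finally have "norm (P g t - P h t) \<le> exp (- c * s) * (1 / 2 * dist g h * exp (c * s))"
      unfolding P_def s_def[symmetric] by (simp flip: scaleR_diff_right)
    also have "\<dots> = 1 / 2 * dist g h" by (simp add: algebra_simps flip: exp_add)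
    finally show "dist (apply_bcontfun (\<Phi> g) t) (apply_bcontfun (\<Phi> h) t) \<le> 1 / 2 * dist g h"
      by (simp add: \<Phi> dist_norm)
  qed
  then obtain g where g: "\<Phi> g = g"
    using banach_fix_type[of "1/2" \<Phi>] by auto
  define X where "X s = exp (c * s) *\<^sub>R apply_bcontfun g s" for s
  have XI: "X s = I g s" if "0 \<le> s" for s
  proof -
    have "apply_bcontfun g s = P g s" using \<Phi>[of g] g by simp
    then show ?thesis using that by (simp add: X_def P_def flip: exp_add)
  qed
  have "(X has_vector_derivative F (X t)) (at t within {0..})" if "0 \<le> t" for t
  proof -
    have "(X has_vector_derivative f g t) (at t within {0..})"
      by (rule has_vector_derivative_transform[OF _ _ Ideriv]) (use that XI in auto)
    then show ?thesis by (simp add: f_def X_def)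
  qed
  moreover have "X 0 = x0" using XI[of 0] by (simp add: I_def)
  ultimately show ?thesis by blast
qed


text \<open>Gronwall's estimate in differential form: by the Lipschitz condition the squared distance of
  two solutions, weighted by \<open>exp (- 2 L t)\<close>, is nonincreasing.\<close>

lemma solution_unique:
  fixes F :: "'a::real_inner \<Rightarrow> 'a"
  assumes Lip: "L-lipschitz_on S F"
    and X: "\<And>t. 0 \<le> t \<Longrightarrow> X t \<in> S"
      "\<And>t. 0 \<le> t \<Longrightarrow> (X has_vector_derivative F (X t)) (at t within {0..})"
    and Y: "\<And>t. 0 \<le> t \<Longrightarrow> Y t \<in> S"
      "\<And>t. 0 \<le> t \<Longrightarrow> (Y has_vector_derivative F (Y t)) (at t within {0..})"
    and "X 0 = Y 0" "0 \<le> t"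
  shows "X t = Y t"
proof (cases "t = 0")
  case False
  then have t: "0 < t" using \<open>0 \<le> t\<close> by simp
  define D where "D s = X s - Y s" for s
  define D' where "D' s = F (X s) - F (Y s)" for s
  define g where "g s = (D s \<bullet> D s) * exp (- (2 * L) * s)" for s
  define g' where "g' s = (2 * (D s \<bullet> D' s) - 2 * L * (D s \<bullet> D s)) * exp (- (2 * L) * s)" for s
  have g: "(g has_real_derivative g' s) (at s within {0..t})" if "s \<in> {0..t}" for s
  proof -
    have "(D has_vector_derivative D' s) (at s within {0..t})"
      unfolding D_def D'_def
      by (intro has_vector_derivative_diff has_vector_derivative_within_subset[OF X(2)]
          has_vector_derivative_within_subset[OF Y(2)]) (use that in auto)
    from bounded_bilinear.has_vector_derivative[OF bounded_bilinear_inner this this]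
    have "((\<lambda>s. D s \<bullet> D s) has_real_derivative 2 * (D s \<bullet> D' s)) (at s within {0..t})"
      by (simp add: has_real_derivative_iff_has_vector_derivative inner_commute)
    then show ?thesis
      unfolding g_def g'_def by (auto intro!: derivative_eq_intros simp: algebra_simps)
  qed
  have "g' s \<le> 0" if "s \<in> {0..t}" for s
  proof -
    have "D s \<bullet> D' s \<le> norm (D s) * norm (D' s)" by (rule norm_cauchy_schwarz)
    also have "\<dots> \<le> norm (D s) * (L * norm (D s))"
      unfolding D_def D'_def
      by (intro mult_left_mono lipschitz_on_normD[OF Lip] X Y) (use that in auto)
    also have "\<dots> = L * (D s \<bullet> D s)" by (simp add: dot_square_norm power2_eq_square)
    finally show ?thesis unfolding g'_def by (intro mult_nonpos_nonneg) auto
  qed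
  moreover have "\<exists>\<xi>\<in>{0<..<t}. g t - g 0 = g' \<xi> * (t - 0)"
    using g by (intro mvt_simple[OF t]) (simp add: has_field_derivative_def)
  ultimately obtain \<xi> where "g t - g 0 = g' \<xi> * t" "g' \<xi> \<le> 0" by force
  then have "g t \<le> g 0"
    using mult_nonpos_nonneg[of "g' \<xi>" t] t by simp
  then have "(D t \<bullet> D t) * exp (- (2 * L) * t) \<le> 0"
    using \<open>X 0 = Y 0\<close> by (simp add: g_def D_def)
  then have "D t \<bullet> D t \<le> 0" by (simp add: mult_le_0_iff)
  then have "D t = 0" by (metis inner_gt_zero_iff not_le)
  then show ?thesis by (simp add: D_def)
qed (use assms in simp)

lemma has_vector_derivative_vecI:
  fixes X :: "real \<Rightarrow> real ^ 'k::finite"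
  assumes "\<And>k. ((\<lambda>s. X s $ k) has_real_derivative X' $ k) (at t within S)"
  shows "(X has_vector_derivative X') (at t within S)"
  unfolding has_vector_derivative_def
proof (subst has_derivative_componentwise_within, rule ballI)
  fix i :: "real ^ 'k" assume "i \<in> Basis"
  then obtain k where "i = axis k 1" by (auto simp: Basis_vec_def)
  then show "((\<lambda>s. X s \<bullet> i) has_derivative (\<lambda>h. (h *\<^sub>R X') \<bullet> i)) (at t within S)"
    using assms[of k] by (simp add: inner_axis has_field_derivative_def mult_commute_abs)
qed

lemma has_real_derivative_vecD:
  assumes "(X has_vector_derivative X') (at t within S)"
  shows "((\<lambda>s. X s $ k) has_real_derivative X' $ k) (at t within S)"
  using bounded_linear.has_vector_derivative[OF bounded_linear_vec_nth assms]
  by (simp add: has_real_derivative_iff_has_vector_derivative)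

text \<open>Otherwise let \<open>s\<close> be the last time before \<open>t\<close> with \<open>u s \<ge> 0\<close>. By the mean value theorem the
  derivative is negative at some point between \<open>s\<close> and \<open>t\<close>, where \<open>u\<close> is negative.\<close>

lemma nonneg_if_deriv_pos_when_neg:
  fixes u :: "real \<Rightarrow> real"
  assumes deriv: "\<And>t. 0 \<le> t \<Longrightarrow> (u has_real_derivative u' t) (at t within {0..})"
    and pos: "\<And>t. 0 \<le> t \<Longrightarrow> u t < 0 \<Longrightarrow> 0 < u' t"
    and "0 \<le> u 0" "0 \<le> t"
  shows "0 \<le> u t"
proof (rule ccontr)
  assume neg: "\<not> 0 \<le> u t"
  have deriv': "(u has_real_derivative u' s) (at s within {p..q})" if "0 \<le> p" "s \<in> {p..q}" for s p q
    by (rule DERIV_subset[OF deriv]) (use that in auto)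
  then have cont: "continuous_on {0..t} u" by (intro DERIV_continuous_on) auto
  have "compact ({0..t} \<inter> u -` {0..})"
    using continuous_closed_preimage[OF cont, of "{0..}"]
    by (auto simp: compact_eq_bounded_closed intro: bounded_subset[of "{0..t}"])
  moreover have "0 \<in> {0..t} \<inter> u -` {0..}" using assms by auto
  ultimately obtain s where "s \<in> {0..t} \<inter> u -` {0..}" "\<forall>z\<in>{0..t} \<inter> u -` {0..}. z \<le> s"
    using compact_attains_sup[of "{0..t} \<inter> u -` {0..}"] by blast
  then have s: "s \<in> {0..t}" "0 \<le> u s" "\<And>z. z \<in> {0..t} \<Longrightarrow> 0 \<le> u z \<Longrightarrow> z \<le> s" by auto
  then have "s < t" using neg by (cases "s = t") auto
  have "\<exists>\<xi>\<in>{s<..<t}. u t - u s = u' \<xi> * (t - s)"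
    using deriv' s by (intro mvt_simple[OF \<open>s < t\<close>]) (simp add: has_field_derivative_def)
  then obtain \<xi> where \<xi>: "\<xi> \<in> {s<..<t}" "u t - u s = u' \<xi> * (t - s)" by blast
  then have "u \<xi> < 0" using s(3)[of \<xi>] s(1) by force
  then have "0 < u' \<xi>" using pos[of \<xi>] \<xi> s by simp
  then have "0 < u' \<xi> * (t - s)" using \<open>s < t\<close> by simp
  then show False using \<xi> s neg by simp
qed

section \<open>Sample paths that follow a differential equation\<close>

lemma discrete_Gronwall:
  fixes c e :: "nat \<Rightarrow> real"
  assumes "\<And>m. m < n \<Longrightarrow> 0 \<le> c m" and "0 \<le> A"
    and le: "\<And>m. m \<le> n \<Longrightarrow> e m \<le> A + (\<Sum>j<m. c j * e j)"
  shows "e n \<le> A * exp (\<Sum>j<n. c j)"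
proof -
  have "A + (\<Sum>j<m. c j * e j) \<le> A * exp (\<Sum>j<m. c j)" if "m \<le> n" for m
    using that
  proof (induction m)
    case (Suc m)
    let ?u = "A + (\<Sum>j<m. c j * e j)"
    have c: "0 \<le> c m" using Suc.prems assms(1) by simp
    have "A + (\<Sum>j<Suc m. c j * e j) = ?u + c m * e m" by simp
    also have "\<dots> \<le> ?u + c m * ?u"
      using c le[of m] Suc.prems by (intro add_left_mono mult_left_mono) auto
    also have "\<dots> = (1 + c m) * ?u" by (simp add: algebra_simps)
    also have "\<dots> \<le> (1 + c m) * (A * exp (\<Sum>j<m. c j))"
      using c Suc by (intro mult_left_mono) auto
    also have "\<dots> \<le> exp (c m) * (A * exp (\<Sum>j<m. c j))"
      using c \<open>0 \<le> A\<close> by (intro mult_right_mono) auto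
    finally show ?case by (simp add: exp_add mult_ac)
  qed simp
  from order_trans[OF le this] show ?thesis by simp
qed

text \<open>The speed is bounded up to a horizon \<open>H\<close> only, because \<open>X\<close> and \<open>F\<close> may be unbounded.\<close>

locale lipschitz_flow =
  fixes F :: "'a::real_normed_vector \<Rightarrow> 'a" and S :: "'a set" and L :: real
    and X :: "real \<Rightarrow> 'a" and H B :: real
  assumes Lip: "L-lipschitz_on S F"
    and X_in: "\<And>t. 0 \<le> t \<Longrightarrow> X t \<in> S"
    and X_deriv: "\<And>t. 0 \<le> t \<Longrightarrow> (X has_vector_derivative F (X t)) (at t within {0..})"
    and speed: "\<And>t. 0 \<le> t \<Longrightarrow> t \<le> H \<Longrightarrow> norm (F (X t)) \<le> B"
    and B_nonneg: "0 \<le> B"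
begin

lemma L_nonneg: "0 \<le> L"
  using Lip by (rule lipschitz_on_nonneg)

lemma X_deriv_Icc:
  assumes "0 \<le> s" "u \<in> {s..t}"
  shows "(X has_vector_derivative F (X u)) (at u within {s..t})"
  by (rule has_vector_derivative_within_subset[OF X_deriv]) (use assms in auto)

lemma X_Lipschitz:
  assumes "0 \<le> s" "s \<le> t" "t \<le> H"
  shows "norm (X t - X s) \<le> B * (t - s)"
proof -
  have "norm (X t - X s) \<le> B * norm (t - s)"
  proof (rule differentiable_bound[where S = "{s..t}" and f' = "\<lambda>u h. h *\<^sub>R F (X u)"])
    fix u assume u: "u \<in> {s..t}"
    show "(X has_derivative (\<lambda>h. h *\<^sub>R F (X u))) (at u within {s..t})"
      using X_deriv_Icc[OF \<open>0 \<le> s\<close> u] by (simp add: has_vector_derivative_def)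
    have "norm (F (X u)) \<le> B" using speed[of u] u assms by simp
    then show "onorm (\<lambda>h. h *\<^sub>R F (X u)) \<le> B"
      by (intro onorm_le) (simp add: mult.commute[of B] mult_left_mono)
  qed (use assms in auto)
  then show ?thesis using assms by simp
qed

lemma euler_step_error:
  assumes "0 \<le> s" "s \<le> t" "t \<le> H"
  shows "norm (X t - X s - (t - s) *\<^sub>R F (X s)) \<le> (t - s) * (L * B * (t - s))"
proof -
  have "norm (X t - X s - (t - s) *\<^sub>R F (X s)) \<le> norm (t - s) * (L * B * (t - s))"
  proof (rule vector_differentiable_bound_linearization[where S = "{s..t}"])
    fix u assume u: "u \<in> {s..t}"
    show "(X has_vector_derivative F (X u)) (at u within {s..t})"
      by (rule X_deriv_Icc[OF \<open>0 \<le> s\<close> u])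
    have "norm (F (X u) - F (X s)) \<le> L * norm (X u - X s)"
      using u assms by (intro lipschitz_on_normD[OF Lip] X_in) auto
    also have "\<dots> \<le> L * (B * (u - s))"
      using u assms by (intro mult_left_mono X_Lipschitz L_nonneg) auto
    also have "\<dots> \<le> L * (B * (t - s))"
      using u B_nonneg L_nonneg by (intro mult_left_mono) auto
    finally show "norm (F (X u) - F (X s)) \<le> L * B * (t - s)" by simp
  qed (use assms in \<open>auto simp: closed_segment_eq_real_ivl\<close>)
  then show ?thesis using assms by simp
qed

text \<open>A scheme with steps of length \<open>\<theta> m \<le> \<kappa>\<close> whose accumulated perturbations never exceed \<open>\<delta>\<close>. Its
  distance from the solution comes from the initial error, the perturbations, the errors of the
  Euler steps (of order \<open>\<theta> m * \<kappa>\<close> each, so of order \<open>\<kappa>\<close> in total) and the propagation of previous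
  errors, which Gronwall's inequality takes care of.\<close>

lemma perturbed_euler:
  fixes n :: nat
  assumes \<theta>: "\<And>m. m < n \<Longrightarrow> 0 \<le> \<theta> m" "\<And>m. m < n \<Longrightarrow> \<theta> m \<le> \<kappa>"
    and Z: "\<And>m. m \<le> n \<Longrightarrow> Z m \<in> S"
    and \<delta>: "\<And>m. m \<le> n \<Longrightarrow> norm (Z m - Z 0 - (\<Sum>j<m. \<theta> j *\<^sub>R F (Z j))) \<le> \<delta>"
    and H: "(\<Sum>j<n. \<theta> j) \<le> H" and "0 \<le> \<kappa>"
  shows "norm (Z n - X (\<Sum>j<n. \<theta> j)) \<le> (norm (Z 0 - X 0) + \<delta> + L * B * \<kappa> * H) * exp (L * H)"
proof -
  define \<Theta> where "\<Theta> m = (\<Sum>j<m. \<theta> j)" for m :: nat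
  have \<Theta>_Suc: "\<Theta> (Suc m) = \<Theta> m + \<theta> m" and \<Theta>_0: "\<Theta> 0 = 0" for m
    by (simp_all add: \<Theta>_def)
  have \<Theta>_nonneg: "0 \<le> \<Theta> m" if "m \<le> n" for m
    unfolding \<Theta>_def using \<theta> that by (intro sum_nonneg) auto
  have \<Theta>_H: "\<Theta> m \<le> H" if "m \<le> n" for m
  proof -
    have "\<Theta> m \<le> \<Theta> n" unfolding \<Theta>_def using \<theta> that by (intro sum_mono2) auto
    then show ?thesis using H by (simp add: \<Theta>_def)
  qed
  define A where "A = norm (Z 0 - X 0) + \<delta> + L * B * \<kappa> * H"
  define e where "e m = norm (Z m - X (\<Theta> m))" for m
  have "0 \<le> \<delta>" using order_trans[OF norm_ge_zero \<delta>[of 0]] by simp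
  moreover have "0 \<le> H" using \<Theta>_nonneg[of n] \<Theta>_H[of n] by simp
  ultimately have A: "0 \<le> A"
    unfolding A_def using L_nonneg B_nonneg \<open>0 \<le> \<kappa>\<close> by simp
  have "e m \<le> A + (\<Sum>j<m. L * \<theta> j * e j)" if "m \<le> n" for m
  proof -
    define G where "G j = \<theta> j *\<^sub>R (F (Z j) - F (X (\<Theta> j)))" for j
    define E where "E j = X (\<Theta> (Suc j)) - X (\<Theta> j) - \<theta> j *\<^sub>R F (X (\<Theta> j))" for j
    have tele: "(\<Sum>j<m. X (\<Theta> (Suc j))) - (\<Sum>j<m. X (\<Theta> j)) = X (\<Theta> m) - X 0"
      using sum_lessThan_telescope[of "\<lambda>j. X (\<Theta> j)" m] by (simp add: \<Theta>_0 sum_subtractf)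
    have "Z m - X (\<Theta> m) = (Z m - Z 0 - (\<Sum>j<m. \<theta> j *\<^sub>R F (Z j))) + (Z 0 - X 0)
        + (\<Sum>j<m. G j) - (\<Sum>j<m. E j)"
      unfolding G_def E_def by (simp add: sum_subtractf scaleR_diff_right tele)
    then have "e m \<le> norm (Z m - Z 0 - (\<Sum>j<m. \<theta> j *\<^sub>R F (Z j))) + norm (Z 0 - X 0)
        + norm (\<Sum>j<m. G j) + norm (\<Sum>j<m. E j)"
      unfolding e_def by (smt (verit) norm_triangle_ineq norm_triangle_ineq4)
    moreover have "norm (\<Sum>j<m. G j) \<le> (\<Sum>j<m. L * \<theta> j * e j)"
    proof (rule sum_norm_le)
      fix j assume j: "j \<in> {..<m}"
      have "norm (G j) = \<theta> j * norm (F (Z j) - F (X (\<Theta> j)))"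
        using \<theta>(1)[of j] j that by (simp add: G_def)
      also have "\<dots> \<le> \<theta> j * (L * norm (Z j - X (\<Theta> j)))"
        using j that by (intro mult_left_mono lipschitz_on_normD[OF Lip] Z X_in \<Theta>_nonneg \<theta>) auto
      finally show "norm (G j) \<le> L * \<theta> j * e j" by (simp add: e_def mult_ac)
    qed
    moreover have "norm (\<Sum>j<m. E j) \<le> (\<Sum>j<m. \<theta> j * (L * B * \<kappa>))"
    proof (rule sum_norm_le)
      fix j assume j: "j \<in> {..<m}"
      then have \<theta>j: "0 \<le> \<theta> j" "\<theta> j \<le> \<kappa>" using \<theta> that by auto
      have "norm (E j) \<le> \<theta> j * (L * B * \<theta> j)"
        using euler_step_error[of "\<Theta> j" "\<Theta> (Suc j)"] \<Theta>_nonneg[of j] \<Theta>_H[of "Suc j"] j that \<theta>j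
        by (simp add: E_def \<Theta>_Suc)
      also have "\<dots> \<le> \<theta> j * (L * B * \<kappa>)"
        using \<theta>j L_nonneg B_nonneg by (intro mult_left_mono) auto
      finally show "norm (E j) \<le> \<theta> j * (L * B * \<kappa>)" .
    qed
    moreover have "(\<Sum>j<m. \<theta> j * (L * B * \<kappa>)) \<le> L * B * \<kappa> * H"
    proof -
      have "(\<Sum>j<m. \<theta> j * (L * B * \<kappa>)) = (L * B * \<kappa>) * \<Theta> m"
        by (simp add: \<Theta>_def sum_distrib_left mult_ac)
      also have "\<dots> \<le> (L * B * \<kappa>) * H"
        using \<Theta>_H[OF that] L_nonneg B_nonneg \<open>0 \<le> \<kappa>\<close> by (intro mult_left_mono) auto
      finally show ?thesis .
    qed
    ultimately show ?thesis using \<delta>[OF that] unfolding A_def by linarith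
  qed
  then have "e n \<le> A * exp (\<Sum>j<n. L * \<theta> j)"
    using \<theta> L_nonneg A by (intro discrete_Gronwall) auto
  also have "(\<Sum>j<n. L * \<theta> j) = L * \<Theta> n" by (simp add: \<Theta>_def sum_distrib_left)
  also have "A * exp (L * \<Theta> n) \<le> A * exp (L * H)"
    using A \<Theta>_H[of n] L_nonneg by (intro mult_left_mono) (auto intro: mult_left_mono)
  finally show ?thesis by (simp add: e_def A_def \<Theta>_def)
qed

text \<open>\<open>s m\<close> is the time that the path \<open>f\<close> spends in its state \<open>Z m\<close>, and \<open>\<theta> m\<close> stands for the mean
  of this time. The states are compared with the solution at the times of the clock \<open>\<Sum>\<theta>\<close>, which is
  then replaced by the true time. A bound on the jump rates is available near the solution only
  (hypothesis \<open>slow\<close>). This suffices: as long as the clock has not passed \<open>H\<close>, the states are near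
  the solution, so each jump advances the clock by at least \<open>1 / \<Lambda>\<close>; hence the clock passes \<open>H\<close>
  within \<open>n1\<close> jumps, the range in which the perturbations are controlled.\<close>

lemma jump_path_near_solution:
  assumes \<theta>: "\<And>m. 0 \<le> \<theta> m" "\<And>m. \<theta> m \<le> \<kappa>"
    and Z: "\<And>m. Z m \<in> S"
    and \<delta>: "\<And>m. m \<le> n1 \<Longrightarrow> norm (Z m - Z 0 - (\<Sum>j<m. \<theta> j *\<^sub>R F (Z j))) \<le> \<delta>"
    and clock: "\<And>m. m \<le> n1 \<Longrightarrow> \<bar>(\<Sum>j<m. s j) - (\<Sum>j<m. \<theta> j)\<bar> \<le> \<delta>"
    and slow: "\<And>m u. 0 \<le> u \<Longrightarrow> u \<le> H \<Longrightarrow> norm (Z m - X u) \<le> 1 \<Longrightarrow> 1 / \<Lambda> \<le> \<theta> m"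
    and \<Lambda>: "0 < \<Lambda>" "\<Lambda> * H \<le> real n1"
    and \<eta>: "(norm (Z 0 - X 0) + \<delta> + L * B * \<kappa> * H) * exp (L * H) \<le> \<eta>" "\<eta> \<le> 1"
    and path: "\<And>n t. (\<Sum>j<n. s j) \<le> t \<Longrightarrow> t < (\<Sum>j<Suc n. s j) \<Longrightarrow> f t = Z n"
    and t: "0 \<le> t" "t + \<delta> < H"
  shows "norm (f t - X t) \<le> \<eta> + B * (\<delta> + \<kappa>)"
proof -
  define \<Theta> where "\<Theta> m = (\<Sum>j<m. \<theta> j)" for m :: nat
  define T where "T m = (\<Sum>j<m. s j)" for m :: nat
  have \<Theta>_mono: "\<Theta> m \<le> \<Theta> n" if "m \<le> n" for m n
    unfolding \<Theta>_def using \<theta> that by (intro sum_mono2) auto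
  have \<Theta>_nonneg: "0 \<le> \<Theta> m" for m
    unfolding \<Theta>_def using \<theta> by (intro sum_nonneg) auto
  have "0 \<le> \<kappa>" using \<theta>[of 0] by simp
  have close: "norm (Z m - X (\<Theta> m)) \<le> \<eta>" if "m \<le> n1" "\<Theta> m \<le> H" for m
  proof -
    have "norm (Z m - X (\<Theta> m)) \<le> (norm (Z 0 - X 0) + \<delta> + L * B * \<kappa> * H) * exp (L * H)"
      unfolding \<Theta>_def
      by (rule perturbed_euler) (use that \<theta> Z \<delta> \<open>0 \<le> \<kappa>\<close> in \<open>auto simp: \<Theta>_def\<close>)
    with \<eta>(1) show ?thesis by simp
  qed
  have reach: "H \<le> \<Theta> n1"
  proof (rule ccontr)
    assume less: "\<not> H \<le> \<Theta> n1"
    have "1 / \<Lambda> \<le> \<theta> m" if "m < n1" for m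
    proof (rule slow)
      show "\<Theta> m \<le> H" using \<Theta>_mono[of m n1] less that by simp
      then show "norm (Z m - X (\<Theta> m)) \<le> 1" using close[of m] that \<eta>(2) by simp
    qed (rule \<Theta>_nonneg)
    then have "(\<Sum>j<n1. 1 / \<Lambda>) \<le> \<Theta> n1" unfolding \<Theta>_def by (intro sum_mono) auto
    moreover have "H \<le> real n1 / \<Lambda>" using \<Lambda> by (simp add: field_simps)
    ultimately show False using less by simp
  qed
  have T_\<Theta>: "\<bar>T m - \<Theta> m\<bar> \<le> \<delta>" if "m \<le> n1" for m
    using clock[OF that] by (simp add: T_def \<Theta>_def)
  then have late: "t < T n1" using reach t by fastforce
  define n where "n = (LEAST n. t < T (Suc n))"
  have "0 < n1" using late t by (cases n1) (auto simp: T_def)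
  then have ex: "t < T (Suc (n1 - 1))" using late by simp
  then have tn: "t < T (Suc n)" unfolding n_def by (rule LeastI)
  have n: "Suc n \<le> n1" using Least_le[of "\<lambda>n. t < T (Suc n)", OF ex] \<open>0 < n1\<close> unfolding n_def by simp
  have Tn: "T n \<le> t"
  proof (cases n)
    case (Suc m)
    then have "\<not> t < T (Suc m)" using not_less_Least[of m "\<lambda>n. t < T (Suc n)"] n_def by simp
    then show ?thesis using Suc by simp
  qed (use t in \<open>simp add: T_def\<close>)
  have ft: "f t = Z n" using path[of n t] Tn tn by (simp add: T_def)
  have \<Theta>n: "\<Theta> n \<le> H" using T_\<Theta>[of n] n Tn t by auto
  have "\<Theta> (Suc n) \<le> \<Theta> n + \<kappa>" using \<theta> by (simp add: \<Theta>_def)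
  then have dist: "\<bar>t - \<Theta> n\<bar> \<le> \<delta> + \<kappa>"
    using T_\<Theta>[of n] T_\<Theta>[of "Suc n"] n Tn tn \<open>0 \<le> \<kappa>\<close> by linarith
  have "0 \<le> \<delta>" using T_\<Theta>[of 0] by simp
  have "norm (X (\<Theta> n) - X t) \<le> B * \<bar>t - \<Theta> n\<bar>"
    using X_Lipschitz[of t "\<Theta> n"] X_Lipschitz[of "\<Theta> n" t] t \<Theta>n \<Theta>_nonneg[of n] \<open>0 \<le> \<delta>\<close>
    by (cases "t \<le> \<Theta> n") (auto simp: norm_minus_commute)
  also have "\<dots> \<le> B * (\<delta> + \<kappa>)" using dist B_nonneg by (rule mult_left_mono)
  finally have "norm (X (\<Theta> n) - X t) \<le> B * (\<delta> + \<kappa>)" .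
  moreover have "norm (Z n - X (\<Theta> n)) \<le> \<eta>" using close[of n] n \<Theta>n by simp
  ultimately show ?thesis
    unfolding ft using norm_triangle_ineq[of "Z n - X (\<Theta> n)" "X (\<Theta> n) - X t"] by simp
qed

end

section \<open>Independent exponential times\<close>

text \<open>Positive times are independent and exponential as soon as their joint tail has product form:
  the sets \<open>{a<..}\<close> form an intersection-stable generator of the Borel sets, and for positive times
  the negative \<open>a\<close> may be replaced by 0.\<close>

lemma (in prob_space) independent_exponential_timesI:
  fixes S :: "nat \<Rightarrow> 'a \<Rightarrow> real"
  assumes S_meas: "\<And>m. S m \<in> borel_measurable M"
    and S_pos: "\<And>m \<omega>. \<omega> \<in> space M \<Longrightarrow> 0 < S m \<omega>"
    and q: "\<And>m. m < n \<Longrightarrow> 0 < q m"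
    and tails: "\<And>s. (\<forall>m<n. 0 \<le> s m) \<Longrightarrow>
      prob {\<omega> \<in> space M. \<forall>m<n. s m < S m \<omega>} = (\<Prod>m<n. exp (- q m * s m))"
  shows "\<And>m. m < n \<Longrightarrow> distributed M lborel (S m) (exponential_density (q m))"
    and "indep_vars (\<lambda>_. borel) S {..<n}"
proof -
  note [measurable] = S_meas
  have tail1: "prob {\<omega> \<in> space M. a < S m \<omega>} = exp (- q m * a)" if "m < n" "0 \<le> a" for m a
  proof -
    have "{\<omega> \<in> space M. a < S m \<omega>} = {\<omega> \<in> space M. \<forall>j<n. (if j = m then a else 0) < S j \<omega>}"
      using that S_pos by auto
    then have "prob {\<omega> \<in> space M. a < S m \<omega>} = (\<Prod>j<n. exp (- q j * (if j = m then a else 0)))"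
      using tails[of "\<lambda>j. if j = m then a else 0"] that by simp
    also have "\<dots> = (\<Prod>j<n. if j = m then exp (- q m * a) else 1)"
      by (intro prod.cong) auto
    also have "\<dots> = exp (- q m * a)" using that by simp
    finally show ?thesis .
  qed
  show "distributed M lborel (S m) (exponential_density (q m))" if "m < n" for m
  proof (subst exponential_distributed_iff[OF q[OF that]], intro conjI allI impI)
    fix a :: real assume "0 \<le> a"
    have "{\<omega> \<in> space M. S m \<omega> \<le> a} = space M - {\<omega> \<in> space M. a < S m \<omega>}" by auto
    then have "prob {\<omega> \<in> space M. S m \<omega> \<le> a} = 1 - prob {\<omega> \<in> space M. a < S m \<omega>}"
      by (simp add: prob_compl)
    then show "prob {\<omega> \<in> space M. S m \<omega> \<le> a} = 1 - exp (- a * q m)"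
      using tail1[OF that \<open>0 \<le> a\<close>] by (simp add: mult.commute)
  qed simp
  show "indep_vars (\<lambda>_. borel) S {..<n}"
  proof (cases "n = 0")
    case True
    then show ?thesis by (simp add: indep_vars_def indep_sets_def)
  next
    case False
    define E :: "real set set" where "E = insert UNIV (range greaterThan)"
    have sets_E: "sets borel = sigma_sets UNIV E"
    proof
      have "sets borel = sigma_sets UNIV (range (greaterThan :: real \<Rightarrow> _))"
        by (subst borel_Ioi) simp
      also have "\<dots> \<subseteq> sigma_sets UNIV E"
        by (rule sigma_sets_mono') (auto simp: E_def)
      finally show "sets borel \<subseteq> sigma_sets UNIV E" .
      have "E \<subseteq> sets borel" by (auto simp: E_def)
      from sets.sigma_sets_subset[OF this] show "sigma_sets UNIV E \<subseteq> sets borel" by simp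
    qed
    have "{x<..} \<inter> {y<..} = {max x y<..}" for x y :: real by auto
    then have "Int_stable E"
      by (intro Int_stableI) (auto simp: E_def)
    have "indep_vars (\<lambda>_. borel) S {..<n} \<longleftrightarrow> (\<forall>A\<in>{..<n} \<rightarrow> E.
       prob (\<Inter>j\<in>{..<n}. S j -` A j \<inter> space M) = (\<Prod>j\<in>{..<n}. prob (S j -` A j \<inter> space M)))"
      by (rule indep_vars_finite) (use False sets_E \<open>Int_stable E\<close> in \<open>auto simp: E_def\<close>)
    also have \<dots>
    proof
      fix A assume A: "A \<in> {..<n} \<rightarrow> E"
      have "\<exists>s\<ge>0. S j -` A j \<inter> space M = {\<omega> \<in> space M. s < S j \<omega>}" if j: "j < n" for j
      proof -
        consider "A j = UNIV" | a where "A j = {a<..}"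
          using Pi_mem[OF A, of j] j by (auto simp: E_def)
        then show ?thesis
        proof cases
          case 1
          then show ?thesis using S_pos by (intro exI[of _ 0]) auto
        next
          case 2
          then show ?thesis using S_pos by (intro exI[of _ "max a 0"]) auto
        qed
      qed
      then obtain s where s: "\<And>j. j < n \<Longrightarrow> 0 \<le> s j"
        "\<And>j. j < n \<Longrightarrow> S j -` A j \<inter> space M = {\<omega> \<in> space M. s j < S j \<omega>}" by metis
      have "(\<Inter>j\<in>{..<n}. S j -` A j \<inter> space M) = {\<omega> \<in> space M. \<forall>j<n. s j < S j \<omega>}"
        using s(2) False by auto
      then show "prob (\<Inter>j\<in>{..<n}. S j -` A j \<inter> space M) = (\<Prod>j\<in>{..<n}. prob (S j -` A j \<inter> space M))"
        using s tails[of s] tail1 by simp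
    qed
    finally show ?thesis .
  qed
qed

lemma (in prob_space) variance_sum_exponential_times:
  fixes S :: "nat \<Rightarrow> 'a \<Rightarrow> real"
  assumes q: "\<And>m. m < n \<Longrightarrow> 0 < q m"
    and distr: "\<And>m. m < n \<Longrightarrow> distributed M lborel (S m) (exponential_density (q m))"
    and indep: "indep_vars (\<lambda>_. borel) S {..<n}"
  shows "integrable M (\<lambda>\<omega>. (\<Sum>m<n. S m \<omega> - 1 / q m)\<^sup>2)"
    and "expectation (\<lambda>\<omega>. (\<Sum>m<n. S m \<omega> - 1 / q m)\<^sup>2) = (\<Sum>m<n. 1 / (q m)\<^sup>2)"
proof -
  define D where "D m \<omega> = S m \<omega> - 1 / q m" for m \<omega>
  have int: "integrable M (S m)" "integrable M (\<lambda>\<omega>. (S m \<omega>)\<^sup>2)" if "m < n" for m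
    using erlang_ith_moment_integrable[OF q[OF that] distr[OF that], of 1]
      erlang_ith_moment_integrable[OF q[OF that] distr[OF that], of 2] by simp_all
  have D_int: "integrable M (D m)" if "m < n" for m
    unfolding D_def using int(1)[OF that] by simp
  have D_sq: "integrable M (\<lambda>\<omega>. (D m \<omega>)\<^sup>2)" if "m < n" for m
    unfolding D_def power2_diff using int[OF that] by (simp add: mult_ac)
  have D_mean: "expectation (D m) = 0" if "m < n" for m
    unfolding D_def using int(1)[OF that] exponential_distributed_expectation[OF q distr] that
    by (simp add: prob_space)
  have D_var: "expectation (\<lambda>\<omega>. (D m \<omega>)\<^sup>2) = 1 / (q m)\<^sup>2" if "m < n" for m
    unfolding D_def using exponential_distributed_variance[OF q distr]
      exponential_distributed_expectation[OF q distr] that by simp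
  have D_indep: "indep_vars (\<lambda>_. borel) D {..<n}"
    unfolding D_def by (rule indep_vars_compose2[OF indep]) simp
  have prod: "integrable M (\<lambda>\<omega>. D i \<omega> * D j \<omega>) \<and>
      expectation (\<lambda>\<omega>. D i \<omega> * D j \<omega>) = (if i = j then 1 / (q i)\<^sup>2 else 0)"
    if ij: "i < n" "j < n" for i j
  proof (cases "i = j")
    case True
    then show ?thesis using D_sq D_var ij by (simp add: power2_eq_square)
  next
    case False
    have ind: "indep_vars (\<lambda>_. borel) D {i, j}"
      by (rule indep_vars_subset[OF D_indep]) (use ij in auto)
    have "integrable M (\<lambda>\<omega>. \<Prod>k\<in>{i, j}. D k \<omega>)"
      by (rule indep_vars_integrable[OF _ ind]) (use D_int ij in auto)
    moreover have "expectation (\<lambda>\<omega>. \<Prod>k\<in>{i, j}. D k \<omega>) = (\<Prod>k\<in>{i, j}. expectation (D k))"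
      by (rule indep_vars_lebesgue_integral[OF _ ind]) (use D_int ij in auto)
    ultimately show ?thesis using False D_mean ij by simp
  qed
  have sq: "(\<Sum>m<n. D m \<omega>)\<^sup>2 = (\<Sum>i<n. \<Sum>j<n. D i \<omega> * D j \<omega>)" for \<omega>
    by (simp add: power2_eq_square sum_product)
  show "integrable M (\<lambda>\<omega>. (\<Sum>m<n. S m \<omega> - 1 / q m)\<^sup>2)"
    unfolding D_def[symmetric] sq using prod by (intro Bochner_Integration.integrable_sum) auto
  have "expectation (\<lambda>\<omega>. (\<Sum>m<n. D m \<omega>)\<^sup>2) = (\<Sum>i<n. \<Sum>j<n. expectation (\<lambda>\<omega>. D i \<omega> * D j \<omega>))"
    unfolding sq using prod by (subst Bochner_Integration.integral_sum; (intro sum.cong refl)?;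
      (subst Bochner_Integration.integral_sum)?) auto
  also have "\<dots> = (\<Sum>i<n. \<Sum>j<n. if i = j then 1 / (q i)\<^sup>2 else 0)"
    using prod by (intro sum.cong) auto
  also have "\<dots> = (\<Sum>i<n. 1 / (q i)\<^sup>2)" by (intro sum.cong) auto
  finally show "expectation (\<lambda>\<omega>. (\<Sum>m<n. S m \<omega> - 1 / q m)\<^sup>2) = (\<Sum>m<n. 1 / (q m)\<^sup>2)"
    by (simp add: D_def)
qed

section \<open>Finite paths of a jump process\<close>

primrec paths :: "('s \<Rightarrow> 's set) \<Rightarrow> 's \<Rightarrow> nat \<Rightarrow> 's list set" where
  "paths succs y0 0 = {[y0]}"
| "paths succs y0 (Suc n) = (\<lambda>(w, v). w @ [v]) ` (SIGMA w:paths succs y0 n. succs (last w))"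

lemma length_paths: "w \<in> paths succs y0 n \<Longrightarrow> length w = Suc n"
  by (induction n arbitrary: w) auto

lemma last_path: "w \<in> paths succs y0 n \<Longrightarrow> last w = w ! n"
  using length_paths[of w succs y0 n] by (cases "w = []") (auto simp: last_conv_nth)

lemma paths_nth_0: "w \<in> paths succs y0 n \<Longrightarrow> w ! 0 = y0"
proof (induction n arbitrary: w)
  case (Suc n)
  then show ?case using length_paths by (fastforce simp: nth_append)
qed simp

lemma paths_nth_Suc: "w \<in> paths succs y0 n \<Longrightarrow> m < n \<Longrightarrow> w ! Suc m \<in> succs (w ! m)"
proof (induction n arbitrary: w)
  case (Suc n)
  then obtain u v where w: "w = u @ [v]" "u \<in> paths succs y0 n" "v \<in> succs (last u)" by auto
  with Suc length_paths[OF w(2)] last_path[OF w(2)] show ?case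
    by (cases "m = n") (auto simp: nth_append)
qed simp

lemma finite_paths: "(\<And>u. finite (succs u)) \<Longrightarrow> finite (paths succs y0 n)"
  by (induction n) auto

lemma sum_paths_Suc:
  assumes "\<And>u. finite (succs u)"
  shows "(\<Sum>w\<in>paths succs y0 (Suc n). f w) = (\<Sum>w\<in>paths succs y0 n. \<Sum>v\<in>succs (last w). f (w @ [v]))"
proof -
  have "(\<Sum>w\<in>paths succs y0 (Suc n). f w) =
      (\<Sum>(w, v)\<in>(SIGMA w:paths succs y0 n. succs (last w)). f (w @ [v]))"
    unfolding paths.simps by (subst sum.reindex) (auto simp: inj_on_def case_prod_unfold)
  also have "\<dots> = (\<Sum>w\<in>paths succs y0 n. \<Sum>v\<in>succs (last w). f (w @ [v]))"
    using assms by (subst sum.Sigma) (auto simp: finite_paths)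
  finally show ?thesis .
qed

definition path_weight :: "('s \<Rightarrow> 's \<Rightarrow> real) \<Rightarrow> 's list \<Rightarrow> real" where
  "path_weight p w = (\<Prod>m<length w - 1. p (w ! m) (w ! Suc m))"

definition path_sum :: "('s \<Rightarrow> 's \<Rightarrow> real) \<Rightarrow> 's list \<Rightarrow> real" where
  "path_sum g w = (\<Sum>m<length w - 1. g (w ! m) (w ! Suc m))"

lemma path_weight_snoc:
  assumes "w \<in> paths succs y0 n"
  shows "path_weight p (w @ [v]) = path_weight p w * p (last w) v"
  using length_paths[OF assms] last_path[OF assms]
  by (simp add: path_weight_def nth_append)

lemma path_sum_snoc:
  assumes "w \<in> paths succs y0 n"
  shows "path_sum g (w @ [v]) = path_sum g w + g (last w) v"
  using length_paths[OF assms] last_path[OF assms]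
  by (simp add: path_sum_def nth_append)

text \<open>A jump process in terms of its jump chain \<open>Y\<close> and its holding times \<open>S\<close>. A fixed initial state
  and finitely many possible successors of each state leave only finitely many paths of each
  length, so that expectations of functions of the jump chain are finite sums.\<close>

locale jump_process = prob_space M for M :: "'w measure" +
  fixes p :: "'s::countable \<Rightarrow> 's \<Rightarrow> real" and q :: "'s \<Rightarrow> real" and succs :: "'s \<Rightarrow> 's set" and y0 :: 's
    and Y :: "nat \<Rightarrow> 'w \<Rightarrow> 's" and S :: "nat \<Rightarrow> 'w \<Rightarrow> real"
  assumes Y_meas: "\<And>n. Y n \<in> M \<rightarrow>\<^sub>M count_space UNIV"
    and S_meas: "\<And>n. S n \<in> borel_measurable M"
    and S_pos: "\<And>n \<omega>. \<omega> \<in> space M \<Longrightarrow> 0 < S n \<omega>"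
    and start: "AE \<omega> in M. Y 0 \<omega> = y0"
    and law: "\<And>n y s. (\<forall>m<n. 0 \<le> s m) \<Longrightarrow>
      prob {\<omega>\<in>space M. (\<forall>m\<le>n. Y m \<omega> = y m) \<and> (\<forall>m<n. s m < S m \<omega>)} =
      prob {\<omega>\<in>space M. Y 0 \<omega> = y 0} * (\<Prod>m<n. p (y m) (y (Suc m)) * exp (- q (y m) * s m))"
    and finite_succs: "\<And>u. finite (succs u)"
    and p_nonneg: "\<And>u v. 0 \<le> p u v"
    and sum_p: "\<And>u. (\<Sum>v\<in>succs u. p u v) = 1"
    and q_pos: "\<And>u. 0 < q u"
begin

declare Y_meas [measurable] S_meas [measurable]

definition follows :: "'s list \<Rightarrow> 'w set" where
  "follows w = {\<omega> \<in> space M. \<forall>m<length w. Y m \<omega> = w ! m}"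

lemma sets_follows [measurable]: "follows w \<in> sets M"
  unfolding follows_def by measurable

lemma prob_start: "prob {\<omega> \<in> space M. Y 0 \<omega> = y0} = 1"
  using start by (simp add: prob_Collect_eq_1)

lemma prob_follows_holding:
  assumes w: "w \<in> paths succs y0 n" and s: "\<forall>m<n. 0 \<le> s m"
  shows "prob (follows w \<inter> {\<omega> \<in> space M. \<forall>m<n. s m < S m \<omega>}) =
    path_weight p w * (\<Prod>m<n. exp (- q (w ! m) * s m))"
proof -
  have "follows w \<inter> {\<omega> \<in> space M. \<forall>m<n. s m < S m \<omega>} =
      {\<omega>\<in>space M. (\<forall>m\<le>n. Y m \<omega> = w ! m) \<and> (\<forall>m<n. s m < S m \<omega>)}"
    using length_paths[OF w] by (auto simp: follows_def less_Suc_eq_le)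
  then show ?thesis
    using law[OF s, of "nth w"] prob_start paths_nth_0[OF w] length_paths[OF w]
    by (simp add: path_weight_def prod.distrib)
qed

lemma prob_follows:
  assumes w: "w \<in> paths succs y0 n"
  shows "prob (follows w) = path_weight p w"
proof -
  have "follows w = follows w \<inter> {\<omega> \<in> space M. \<forall>m<n. 0 < S m \<omega>}"
    using S_pos by (auto simp: follows_def)
  then show ?thesis using prob_follows_holding[OF w, of "\<lambda>_. 0"] by simp
qed

lemma path_weight_nonneg: "0 \<le> path_weight p w"
  unfolding path_weight_def by (intro prod_nonneg) (simp add: p_nonneg)

lemma sum_path_weight: "(\<Sum>w\<in>paths succs y0 n. path_weight p w) = 1"
proof (induction n)
  case 0
  then show ?case by (simp add: path_weight_def)
next
  case (Suc n)
  have "(\<Sum>w\<in>paths succs y0 (Suc n). path_weight p w) =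
      (\<Sum>w\<in>paths succs y0 n. path_weight p w * (\<Sum>v\<in>succs (last w). p (last w) v))"
    by (simp add: sum_paths_Suc[OF finite_succs] path_weight_snoc sum_distrib_left
        del: paths.simps(2) cong: sum.cong)
  then show ?case using Suc by (simp add: sum_p)
qed

lemma disjoint_follows:
  assumes "w \<in> paths succs y0 n" "w' \<in> paths succs y0 n" "w \<noteq> w'"
  shows "follows w \<inter> follows w' = {}"
  using assms length_paths[OF assms(1)] length_paths[OF assms(2)]
  by (auto simp: follows_def list_eq_iff_nth_eq)

lemma AE_follows: "AE \<omega> in M. \<exists>w\<in>paths succs y0 n. \<omega> \<in> follows w"
proof -
  have "prob (\<Union>w\<in>paths succs y0 n. follows w) = (\<Sum>w\<in>paths succs y0 n. prob (follows w))"
    using disjoint_follows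
    by (intro finite_measure_finite_Union) (auto simp: finite_paths finite_succs disjoint_family_on_def)
  also have "\<dots> = 1" using sum_path_weight[of n] by (simp add: prob_follows cong: sum.cong)
  finally have "AE \<omega> in M. \<omega> \<in> (\<Union>w\<in>paths succs y0 n. follows w)"
    by (subst (asm) prob_eq_1) (auto simp: finite_paths finite_succs)
  then show ?thesis by simp
qed

lemma AE_succs: "AE \<omega> in M. \<forall>m. Y (Suc m) \<omega> \<in> succs (Y m \<omega>)"
proof (subst AE_all_countable, rule allI)
  fix m
  show "AE \<omega> in M. Y (Suc m) \<omega> \<in> succs (Y m \<omega>)"
    using AE_follows[of "Suc m"]
  proof eventually_elim
    case (elim \<omega>)
    then obtain w where w: "w \<in> paths succs y0 (Suc m)" "\<omega> \<in> follows w" by blast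
    then show ?case using paths_nth_Suc[OF w(1), of m] length_paths[OF w(1)]
      by (simp add: follows_def)
  qed
qed

lemma nn_integral_eq_sum_paths:
  assumes [measurable]: "f \<in> borel_measurable M"
  shows "(\<integral>\<^sup>+ \<omega>. f \<omega> \<partial>M) = (\<Sum>w\<in>paths succs y0 n. \<integral>\<^sup>+ \<omega>. f \<omega> * indicator (follows w) \<omega> \<partial>M)"
proof -
  have "(\<integral>\<^sup>+ \<omega>. f \<omega> \<partial>M) = (\<integral>\<^sup>+ \<omega>. (\<Sum>w\<in>paths succs y0 n. f \<omega> * indicator (follows w) \<omega>) \<partial>M)"
  proof (rule nn_integral_cong_AE)
    show "AE \<omega> in M. f \<omega> = (\<Sum>w\<in>paths succs y0 n. f \<omega> * indicator (follows w) \<omega>)"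
      using AE_follows[of n]
    proof eventually_elim
      case (elim \<omega>)
      then obtain w where w: "w \<in> paths succs y0 n" "\<omega> \<in> follows w" by blast
      have "(\<Sum>v\<in>paths succs y0 n. f \<omega> * indicator (follows v) \<omega>) =
          (\<Sum>v\<in>paths succs y0 n. if v = w then f \<omega> else 0)"
        using w disjoint_follows by (intro sum.cong refl) (auto simp: indicator_def)
      then show ?case using w by (simp add: finite_paths finite_succs)
    qed
  qed
  then show ?thesis by (simp add: nn_integral_sum)
qed

text \<open>The increments \<open>g (Y m) (Y (m + 1))\<close> have mean zero given the past, so the mixed terms vanish
  when the square of the sum is expanded, one increment after the other.\<close>

lemma chain_second_moment:
  assumes bound: "\<And>u v. v \<in> succs u \<Longrightarrow> \<bar>g u v\<bar> \<le> c"
    and centred: "\<And>u. (\<Sum>v\<in>succs u. p u v * g u v) = 0"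
  shows "(\<integral>\<^sup>+ \<omega>. ennreal ((\<Sum>m<n. g (Y m \<omega>) (Y (Suc m) \<omega>))\<^sup>2) \<partial>M) \<le> ennreal (real n * c\<^sup>2)"
proof -
  let ?P = "paths succs y0"
  have "(\<integral>\<^sup>+ \<omega>. ennreal ((\<Sum>m<n. g (Y m \<omega>) (Y (Suc m) \<omega>))\<^sup>2) * indicator (follows w) \<omega> \<partial>M) =
      ennreal (path_weight p w * (path_sum g w)\<^sup>2)" if w: "w \<in> ?P n" for w
  proof -
    have "(\<integral>\<^sup>+ \<omega>. ennreal ((\<Sum>m<n. g (Y m \<omega>) (Y (Suc m) \<omega>))\<^sup>2) * indicator (follows w) \<omega> \<partial>M) =
        (\<integral>\<^sup>+ \<omega>. ennreal ((path_sum g w)\<^sup>2) * indicator (follows w) \<omega> \<partial>M)"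
      using length_paths[OF w]
      by (intro nn_integral_cong) (auto simp: indicator_def follows_def path_sum_def)
    also have "\<dots> = ennreal ((path_sum g w)\<^sup>2) * ennreal (path_weight p w)"
      by (simp add: nn_integral_cmult_indicator emeasure_eq_measure prob_follows[OF w])
    finally show ?thesis by (simp add: ennreal_mult' path_weight_nonneg mult.commute)
  qed
  then have "(\<integral>\<^sup>+ \<omega>. ennreal ((\<Sum>m<n. g (Y m \<omega>) (Y (Suc m) \<omega>))\<^sup>2) \<partial>M) =
      ennreal (\<Sum>w\<in>?P n. path_weight p w * (path_sum g w)\<^sup>2)"
    by (subst nn_integral_eq_sum_paths[of _ n]) (auto simp: path_weight_nonneg cong: sum.cong)
  also have "(\<Sum>w\<in>?P n. path_weight p w * (path_sum g w)\<^sup>2) \<le> real n * c\<^sup>2"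
  proof (induction n)
    case 0
    then show ?case by (simp add: path_sum_def)
  next
    case (Suc n)
    have step: "(\<Sum>v\<in>succs u. p u v * (a + g u v)\<^sup>2) \<le> a\<^sup>2 + c\<^sup>2" for u a
    proof -
      have "(\<Sum>v\<in>succs u. p u v * (a + g u v)\<^sup>2) =
          (\<Sum>v\<in>succs u. a\<^sup>2 * p u v + 2 * a * (p u v * g u v) + p u v * (g u v)\<^sup>2)"
        by (intro sum.cong refl) (simp add: power2_sum algebra_simps)
      also have "\<dots> =
          a\<^sup>2 * (\<Sum>v\<in>succs u. p u v) + 2 * a * (\<Sum>v\<in>succs u. p u v * g u v) + (\<Sum>v\<in>succs u. p u v * (g u v)\<^sup>2)"
        by (simp add: sum_distrib_left sum.distrib)
      also have "\<dots> = a\<^sup>2 + (\<Sum>v\<in>succs u. p u v * (g u v)\<^sup>2)" by (simp add: sum_p centred)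
      also have "(\<Sum>v\<in>succs u. p u v * (g u v)\<^sup>2) \<le> (\<Sum>v\<in>succs u. p u v * c\<^sup>2)"
      proof (intro sum_mono mult_left_mono p_nonneg)
        fix v assume "v \<in> succs u"
        then show "(g u v)\<^sup>2 \<le> c\<^sup>2" using power_mono[OF bound, of v u 2] by simp
      qed
      also have "\<dots> = c\<^sup>2" by (simp add: sum_p flip: sum_distrib_right)
      finally show ?thesis by simp
    qed
    have "(\<Sum>w\<in>?P (Suc n). path_weight p w * (path_sum g w)\<^sup>2) =
        (\<Sum>w\<in>?P n. path_weight p w * (\<Sum>v\<in>succs (last w). p (last w) v * (path_sum g w + g (last w) v)\<^sup>2))"
      by (simp add: sum_paths_Suc[OF finite_succs] path_weight_snoc path_sum_snoc sum_distrib_left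
          mult.assoc del: paths.simps(2) cong: sum.cong)
    also have "\<dots> \<le> (\<Sum>w\<in>?P n. path_weight p w * ((path_sum g w)\<^sup>2 + c\<^sup>2))"
      by (intro sum_mono mult_left_mono step path_weight_nonneg)
    also have "\<dots> = (\<Sum>w\<in>?P n. path_weight p w * (path_sum g w)\<^sup>2) + c\<^sup>2"
      by (simp add: distrib_left sum.distrib sum_path_weight flip: sum_distrib_right)
    finally show ?case using Suc by (simp add: algebra_simps)
  qed
  finally show ?thesis by (simp add: ennreal_leI)
qed

text \<open>Given the jump chain, the sum is a sum of independent centred variables, the variance of which
  is at most \<open>\<kappa>\<^sup>2\<close> each.\<close>

lemma clock_second_moment:
  assumes \<kappa>: "\<And>u. 1 / q u \<le> \<kappa>"
  shows "(\<integral>\<^sup>+ \<omega>. ennreal ((\<Sum>m<n. S m \<omega> - 1 / q (Y m \<omega>))\<^sup>2) \<partial>M) \<le> ennreal (real n * \<kappa>\<^sup>2)"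
proof -
  let ?f = "\<lambda>\<omega>. (\<Sum>m<n. S m \<omega> - 1 / q (Y m \<omega>))\<^sup>2"
  have [measurable]: "(\<lambda>\<omega>. q (Y m \<omega>)) \<in> borel_measurable M" for m
    by (rule measurable_compose[OF Y_meas]) simp
  have "(\<integral>\<^sup>+ \<omega>. ennreal (?f \<omega>) * indicator (follows w) \<omega> \<partial>M) \<le>
      ennreal (path_weight p w * (real n * \<kappa>\<^sup>2))" if w: "w \<in> paths succs y0 n" for w
  proof (cases "path_weight p w = 0")
    case True
    then have "emeasure M (follows w) = 0" using prob_follows[OF w] by (simp add: emeasure_eq_measure)
    then have "AE \<omega> in M. \<omega> \<notin> follows w" by (intro AE_not_in) (auto simp: null_sets_def)
    then have "(\<integral>\<^sup>+ \<omega>. ennreal (?f \<omega>) * indicator (follows w) \<omega> \<partial>M) = (\<integral>\<^sup>+ \<omega>. 0 \<partial>M)"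
      by (intro nn_integral_cong_AE) (auto elim!: eventually_mono)
    then show ?thesis by simp
  next
    case False
    let ?g = "\<lambda>\<omega>. (\<Sum>m<n. S m \<omega> - 1 / q (w ! m))\<^sup>2"
    let ?A = "follows w"
    have pos: "0 < path_weight p w" using False path_weight_nonneg[of w] by simp
    then have pA: "0 < prob ?A" using prob_follows[OF w] by simp
    \<comment> \<open>Given the path \<open>w\<close>, the holding times are independent and exponential.\<close>
    interpret U: prob_space "uniform_measure M ?A"
      by (rule prob_space_uniform_measure) (use pA in \<open>auto simp: emeasure_eq_measure\<close>)
    have tails: "U.prob {\<omega> \<in> space (uniform_measure M ?A). \<forall>m<n. s m < S m \<omega>} =
        (\<Prod>m<n. exp (- q (w ! m) * s m))"
      if s: "\<forall>m<n. 0 \<le> s m" for s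
      using pA pos prob_follows_holding[OF w s] prob_follows[OF w]
      by (simp add: emeasure_eq_measure)
    have S_meas_U: "S m \<in> borel_measurable (uniform_measure M ?A)" for m
      by simp
    have S_pos_U: "0 < S m \<omega>" if "\<omega> \<in> space (uniform_measure M ?A)" for m \<omega>
      using that S_pos by simp
    note exp_times = U.independent_exponential_timesI[of S n "\<lambda>m. q (w ! m)",
        OF S_meas_U S_pos_U q_pos tails]
    have moment: "integrable (uniform_measure M ?A) ?g"
        "U.expectation ?g = (\<Sum>m<n. 1 / (q (w ! m))\<^sup>2)"
      using U.variance_sum_exponential_times[of n "\<lambda>m. q (w ! m)" S, OF q_pos exp_times] by auto
    have "(\<integral>\<^sup>+ \<omega>. ennreal (?f \<omega>) * indicator ?A \<omega> \<partial>M) = (\<integral>\<^sup>+ \<omega>. ennreal (?g \<omega>) * indicator ?A \<omega> \<partial>M)"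
      using length_paths[OF w] by (intro nn_integral_cong) (auto simp: indicator_def follows_def)
    also have "\<dots> = emeasure M ?A * ((\<integral>\<^sup>+ \<omega>. ennreal (?g \<omega>) * indicator ?A \<omega> \<partial>M) / emeasure M ?A)"
      using pA by (subst ennreal_times_divide, subst mult.commute[of "emeasure M ?A"],
          subst mult_divide_eq_ennreal) (auto simp: emeasure_eq_measure)
    also have "(\<integral>\<^sup>+ \<omega>. ennreal (?g \<omega>) * indicator ?A \<omega> \<partial>M) / emeasure M ?A =
        (\<integral>\<^sup>+ \<omega>. ennreal (?g \<omega>) \<partial>uniform_measure M ?A)"
      by (rule nn_integral_uniform_measure[symmetric]) auto
    also have "\<dots> = ennreal (\<Sum>m<n. 1 / (q (w ! m))\<^sup>2)"
      using moment by (subst nn_integral_eq_integral) auto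
    also have "\<dots> \<le> ennreal (real n * \<kappa>\<^sup>2)"
    proof (rule ennreal_leI)
      have "1 / (q u)\<^sup>2 \<le> \<kappa>\<^sup>2" for u
        using power_mono[OF \<kappa>[of u], of 2] q_pos[of u] by (simp add: power_divide)
      then have "(\<Sum>m<n. 1 / (q (w ! m))\<^sup>2) \<le> (\<Sum>m<n. \<kappa>\<^sup>2)" by (intro sum_mono)
      then show "(\<Sum>m<n. 1 / (q (w ! m))\<^sup>2) \<le> real n * \<kappa>\<^sup>2" by simp
    qed
    finally have "(\<integral>\<^sup>+ \<omega>. ennreal (?f \<omega>) * indicator ?A \<omega> \<partial>M) \<le> emeasure M ?A * ennreal (real n * \<kappa>\<^sup>2)"
      by (simp add: mult_left_mono)
    then show ?thesis
      using pos by (simp add: emeasure_eq_measure prob_follows[OF w] ennreal_mult')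
  qed
  then have "(\<integral>\<^sup>+ \<omega>. ennreal (?f \<omega>) \<partial>M) \<le>
      (\<Sum>w\<in>paths succs y0 n. ennreal (path_weight p w * (real n * \<kappa>\<^sup>2)))"
    by (subst nn_integral_eq_sum_paths[of _ n]) (auto intro!: sum_mono)
  also have "\<dots> = ennreal (\<Sum>w\<in>paths succs y0 n. path_weight p w * (real n * \<kappa>\<^sup>2))"
    by (rule sum_ennreal) (simp add: path_weight_nonneg)
  also have "(\<Sum>w\<in>paths succs y0 n. path_weight p w * (real n * \<kappa>\<^sup>2)) = real n * \<kappa>\<^sup>2"
    by (simp add: sum_path_weight flip: sum_distrib_right)
  finally show ?thesis .
qed

lemma measurable_step_sum:
  "(\<lambda>\<omega>. \<Sum>m<n. g (Y m \<omega>) (Y (Suc m) \<omega>) :: real) \<in> borel_measurable M"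
proof (intro borel_measurable_sum)
  fix m
  show "(\<lambda>\<omega>. g (Y m \<omega>) (Y (Suc m) \<omega>)) \<in> borel_measurable M"
    by (rule measurable_compose_countable[OF _ Y_meas], rule measurable_compose[OF Y_meas]) simp
qed

lemma measurable_clock_error:
  "(\<lambda>\<omega>. \<Sum>m<n. S m \<omega> - 1 / q (Y m \<omega>)) \<in> borel_measurable M"
proof -
  have [measurable]: "(\<lambda>\<omega>. q (Y m \<omega>)) \<in> borel_measurable M" for m
    by (rule measurable_compose[OF Y_meas]) simp
  show ?thesis by measurable
qed

end

section \<open>Maxima of processes with small downward jumps\<close>

lemma (in prob_space) second_moment_tail:
  assumes [measurable]: "f \<in> borel_measurable M"
    and moment: "(\<integral>\<^sup>+ \<omega>. ennreal ((f \<omega>)\<^sup>2) \<partial>M) \<le> ennreal b" and "0 \<le> b" "0 < a"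
  shows "prob {\<omega> \<in> space M. a \<le> \<bar>f \<omega>\<bar>} \<le> b / a\<^sup>2"
proof -
  have iff: "1 \<le> ennreal (1 / a\<^sup>2) * ennreal ((f \<omega>)\<^sup>2) \<longleftrightarrow> a \<le> \<bar>f \<omega>\<bar>" for \<omega>
  proof -
    have "a \<le> \<bar>f \<omega>\<bar> \<longleftrightarrow> a\<^sup>2 \<le> (f \<omega>)\<^sup>2" using \<open>0 < a\<close> by (simp flip: abs_le_square_iff)
    also have "\<dots> \<longleftrightarrow> 1 \<le> 1 / a\<^sup>2 * (f \<omega>)\<^sup>2" using \<open>0 < a\<close> by (simp add: field_simps)
    also have "\<dots> \<longleftrightarrow> ennreal 1 \<le> ennreal (1 / a\<^sup>2 * (f \<omega>)\<^sup>2)"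
      by (subst ennreal_le_iff) auto
    also have "\<dots> \<longleftrightarrow> 1 \<le> ennreal (1 / a\<^sup>2) * ennreal ((f \<omega>)\<^sup>2)"
      by (subst ennreal_mult) auto
    finally show ?thesis by simp
  qed
  have "emeasure M {\<omega> \<in> space M. a \<le> \<bar>f \<omega>\<bar>} \<le>
      ennreal (1 / a\<^sup>2) * (\<integral>\<^sup>+ \<omega>. ennreal ((f \<omega>)\<^sup>2) * indicator (space M) \<omega> \<partial>M)"
    using nn_integral_Markov_inequality[where M = M and A = "space M" and
        u = "\<lambda>\<omega>. ennreal ((f \<omega>)\<^sup>2)" and c = "ennreal (1 / a\<^sup>2)"]
    unfolding iff by simp
  also have "(\<integral>\<^sup>+ \<omega>. ennreal ((f \<omega>)\<^sup>2) * indicator (space M) \<omega> \<partial>M) = (\<integral>\<^sup>+ \<omega>. ennreal ((f \<omega>)\<^sup>2) \<partial>M)"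
    by (intro nn_integral_cong) simp
  also have "ennreal (1 / a\<^sup>2) * \<dots> \<le> ennreal (1 / a\<^sup>2) * ennreal b"
    using moment by (rule mult_left_mono) simp
  also have "\<dots> = ennreal (b / a\<^sup>2)" using \<open>0 \<le> b\<close> by (simp add: ennreal_mult[symmetric])
  finally show ?thesis
    using \<open>0 \<le> b\<close> by (simp add: emeasure_eq_measure)
qed

text \<open>As \<open>f\<close> falls by at most \<open>\<kappa>\<close> in a step, it is at least its value at the last multiple of \<open>s\<close>, and
  at most its value at the next one, up to an error of \<open>s \<kappa> \<le> \<delta> / 2\<close>. So Chebyshev's inequality is
  applied at the multiples of \<open>s\<close> only; a union bound over all \<open>n \<le> N\<close> would lose a factor \<open>s\<close>.\<close>

lemma (in prob_space) prob_max_le: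
  fixes f :: "nat \<Rightarrow> 'a \<Rightarrow> real"
  assumes meas [measurable]: "\<And>n. f n \<in> borel_measurable M"
    and steps: "AE \<omega> in M. \<forall>n. f n \<omega> - \<kappa> \<le> f (Suc n) \<omega>"
    and moment: "\<And>n. (\<integral>\<^sup>+ \<omega>. ennreal ((f n \<omega>)\<^sup>2) \<partial>M) \<le> ennreal (real n * v)"
    and "0 \<le> v" "0 \<le> \<kappa>" "0 < \<delta>" "0 < s" "real s * \<kappa> \<le> \<delta> / 2" "N \<le> J * s"
  shows "prob {\<omega> \<in> space M. \<exists>n\<le>N. \<delta> < \<bar>f n \<omega>\<bar>} \<le>
    real (J + 2) * (real ((J + 1) * s) * v * 4 / \<delta>\<^sup>2)"
proof -
  let ?G = "\<lambda>i. {\<omega> \<in> space M. \<delta> / 2 \<le> \<bar>f (i * s) \<omega>\<bar>}"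
  have "prob {\<omega> \<in> space M. \<exists>n\<le>N. \<delta> < \<bar>f n \<omega>\<bar>} \<le> prob (\<Union>i\<in>{..<J + 2}. ?G i)"
  proof (rule finite_measure_mono_AE)
    show "AE \<omega> in M. \<omega> \<in> {\<omega> \<in> space M. \<exists>n\<le>N. \<delta> < \<bar>f n \<omega>\<bar>} \<longrightarrow> \<omega> \<in> (\<Union>i\<in>{..<J + 2}. ?G i)"
      using steps
    proof eventually_elim
      case (elim \<omega>)
      have low: "f n \<omega> - real d * \<kappa> \<le> f (n + d) \<omega>" for n d
      proof (induction d)
        case (Suc d)
        then show ?case using elim[rule_format, of "n + d"] by (simp add: algebra_simps)
      qed simp
      have low': "f n \<omega> - \<delta> / 2 \<le> f m \<omega>" if "n \<le> m" "m \<le> n + s" for n m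
      proof -
        have "real (m - n) * \<kappa> \<le> real s * \<kappa>"
          using that \<open>0 \<le> \<kappa>\<close> by (intro mult_right_mono) auto
        then show ?thesis using low[of n "m - n"] that \<open>real s * \<kappa> \<le> \<delta> / 2\<close> by simp
      qed
      show ?case
      proof (intro impI, rule ccontr)
        assume bad: "\<omega> \<in> {\<omega> \<in> space M. \<exists>n\<le>N. \<delta> < \<bar>f n \<omega>\<bar>}" and "\<omega> \<notin> (\<Union>i\<in>{..<J + 2}. ?G i)"
        then have grid: "\<bar>f (i * s) \<omega>\<bar> < \<delta> / 2" if "i < J + 2" for i using that by force
        obtain n where n: "n \<le> N" "\<delta> < \<bar>f n \<omega>\<bar>" using bad by blast
        define i where "i = n div s"
        have ns: "i * s \<le> n" "n \<le> i * s + s"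
          using div_mult_mod_eq[of n s] mod_less_divisor[OF \<open>0 < s\<close>, of n]
          unfolding i_def by linarith+
        have "n \<le> J * s" using n \<open>N \<le> J * s\<close> by simp
        then have "i \<le> J" using div_le_mono[of n "J * s" s] \<open>0 < s\<close> by (simp add: i_def)
        then have "\<bar>f (i * s) \<omega>\<bar> < \<delta> / 2" "\<bar>f (Suc i * s) \<omega>\<bar> < \<delta> / 2"
          using grid[of i] grid[of "Suc i"] by simp_all
        moreover have "f (i * s) \<omega> - \<delta> / 2 \<le> f n \<omega>" "f n \<omega> - \<delta> / 2 \<le> f (Suc i * s) \<omega>"
          using low'[of "i * s" n] low'[of n "Suc i * s"] ns by (simp_all add: add.commute)
        ultimately show False using n by linarith
      qed
    qed
  qed simp
  also have "\<dots> \<le> (\<Sum>i<J + 2. prob (?G i))"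
    by (rule finite_measure_subadditive_finite) auto
  also have "\<dots> \<le> (\<Sum>i<J + 2. real ((J + 1) * s) * v * 4 / \<delta>\<^sup>2)"
  proof (rule sum_mono)
    fix i assume i: "i \<in> {..<J + 2}"
    have "prob (?G i) \<le> real (i * s) * v / (\<delta> / 2)\<^sup>2"
      by (rule second_moment_tail[OF meas moment]) (use assms in auto)
    also have "\<dots> \<le> real ((J + 1) * s) * v / (\<delta> / 2)\<^sup>2"
    proof -
      have "i * s \<le> (J + 1) * s" using i by (intro mult_le_mono1) auto
      then have "real (i * s) \<le> real ((J + 1) * s)" by (rule of_nat_mono)
      then show ?thesis using \<open>0 \<le> v\<close> by (intro divide_right_mono mult_right_mono) auto
    qed
    finally show "prob (?G i) \<le> real ((J + 1) * s) * v * 4 / \<delta>\<^sup>2" by (simp add: power2_eq_square)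
  qed
  finally show ?thesis by simp
qed

text \<open>With a mesh \<open>s\<close> proportional to \<open>\<beta>\<close>, the number of the multiples of \<open>s\<close> up to \<open>A \<beta>\<close> is bounded
  and the second moments there are of order \<open>1 / \<beta>\<close>.\<close>

lemma prob_max_tendsto_0:
  fixes M :: "nat \<Rightarrow> 'w measure" and f :: "nat \<Rightarrow> nat \<Rightarrow> 'w \<Rightarrow> real"
  assumes P: "\<And>\<beta>. 1 \<le> \<beta> \<Longrightarrow> prob_space (M \<beta>)"
    and meas: "\<And>\<beta> n. 1 \<le> \<beta> \<Longrightarrow> f \<beta> n \<in> borel_measurable (M \<beta>)"
    and steps: "\<And>\<beta>. 1 \<le> \<beta> \<Longrightarrow> AE \<omega> in M \<beta>. \<forall>n. f \<beta> n \<omega> - \<kappa> / real \<beta> \<le> f \<beta> (Suc n) \<omega>"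
    and moment: "\<And>\<beta> n. 1 \<le> \<beta> \<Longrightarrow>
      (\<integral>\<^sup>+ \<omega>. ennreal ((f \<beta> n \<omega>)\<^sup>2) \<partial>M \<beta>) \<le> ennreal (real n * (\<kappa> / real \<beta>)\<^sup>2)"
    and "0 < \<kappa>" "0 < \<delta>" "0 \<le> A"
  shows "(\<lambda>\<beta>. measure (M \<beta>) {\<omega> \<in> space (M \<beta>). \<exists>n\<le>nat \<lceil>A * real \<beta>\<rceil>. \<delta> < \<bar>f \<beta> n \<omega>\<bar>}) \<longlonglongrightarrow> 0"
proof -
  define \<sigma> where "\<sigma> = \<delta> / (2 * \<kappa>)"
  have \<sigma>: "0 < \<sigma>" using assms by (simp add: \<sigma>_def)
  define J where "J = nat \<lceil>2 * (A + 1) / \<sigma>\<rceil>"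
  define K where "K = real (J + 2) * (real (J + 1) * \<sigma> * \<kappa>\<^sup>2 * 4 / \<delta>\<^sup>2)"
  have bound: "measure (M \<beta>) {\<omega> \<in> space (M \<beta>). \<exists>n\<le>nat \<lceil>A * real \<beta>\<rceil>. \<delta> < \<bar>f \<beta> n \<omega>\<bar>} \<le> K / real \<beta>"
    if \<beta>: "1 \<le> \<beta>" "2 / \<sigma> \<le> real \<beta>" for \<beta>
  proof -
    interpret prob_space "M \<beta>" by (rule P[OF \<beta>(1)])
    define s where "s = nat \<lfloor>\<sigma> * real \<beta>\<rfloor>"
    have big: "2 \<le> \<sigma> * real \<beta>" using \<beta> \<sigma> by (simp add: field_simps)
    have s_le: "real s \<le> \<sigma> * real \<beta>" using big by (simp add: s_def)
    have "\<sigma> * real \<beta> - 1 \<le> real s" using big by (simp add: s_def)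
    then have s_ge: "\<sigma> * real \<beta> / 2 \<le> real s" using big by simp
    have "A * real \<beta> + 1 \<le> (A + 1) * real \<beta>" using \<beta> by (simp add: algebra_simps)
    also have "\<dots> = 2 * (A + 1) / \<sigma> * (\<sigma> * real \<beta> / 2)" using \<sigma> by simp
    also have "\<dots> \<le> real J * real s"
      using big s_ge by (intro mult_mono) (auto simp: J_def real_nat_ceiling_ge)
    finally have J: "nat \<lceil>A * real \<beta>\<rceil> \<le> J * s"
      by (simp add: nat_le_iff ceiling_le_iff)
    have "real s * (\<kappa> / real \<beta>) \<le> \<sigma> * real \<beta> * (\<kappa> / real \<beta>)"
      using s_le \<open>0 < \<kappa>\<close> by (intro mult_right_mono) auto
    also have "\<dots> = \<delta> / 2" using \<beta> \<open>0 < \<kappa>\<close> by (simp add: \<sigma>_def)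
    finally have "measure (M \<beta>) {\<omega> \<in> space (M \<beta>). \<exists>n\<le>nat \<lceil>A * real \<beta>\<rceil>. \<delta> < \<bar>f \<beta> n \<omega>\<bar>} \<le>
        real (J + 2) * (real ((J + 1) * s) * (\<kappa> / real \<beta>)\<^sup>2 * 4 / \<delta>\<^sup>2)"
      using J s_ge big assms by (intro prob_max_le[OF meas steps moment] \<beta>(1)) auto
    also have "\<dots> \<le> real (J + 2) * (real (J + 1) * (\<sigma> * real \<beta>) * (\<kappa> / real \<beta>)\<^sup>2 * 4 / \<delta>\<^sup>2)"
    proof -
      have "real ((J + 1) * s) \<le> real (J + 1) * (\<sigma> * real \<beta>)"
        unfolding of_nat_mult using s_le by (intro mult_left_mono) auto
      then show ?thesis by (intro mult_left_mono divide_right_mono mult_right_mono) auto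
    qed
    also have "real (J + 1) * (\<sigma> * real \<beta>) * (\<kappa> / real \<beta>)\<^sup>2 = real (J + 1) * \<sigma> * \<kappa>\<^sup>2 / real \<beta>"
      using \<beta> by (simp add: power_divide power2_eq_square)
    also have "real (J + 2) * (real (J + 1) * \<sigma> * \<kappa>\<^sup>2 / real \<beta> * 4 / \<delta>\<^sup>2) = K / real \<beta>"
      by (simp add: K_def)
    finally show ?thesis .
  qed
  have "\<forall>\<^sub>F \<beta> in sequentially. 1 \<le> \<beta> \<and> 2 / \<sigma> \<le> real \<beta>"
    using filterlim_real_sequentially[unfolded filterlim_at_top]
    by (intro eventually_conj eventually_ge_at_top) blast
  then have "\<forall>\<^sub>F \<beta> in sequentially.
      measure (M \<beta>) {\<omega> \<in> space (M \<beta>). \<exists>n\<le>nat \<lceil>A * real \<beta>\<rceil>. \<delta> < \<bar>f \<beta> n \<omega>\<bar>} \<le> K / real \<beta>"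
    by (rule eventually_mono) (use bound in auto)
  from real_tendsto_sandwich[OF _ this tendsto_const lim_const_over_n] show ?thesis by simp
qed

section \<open>Transition rates of the flow process\<close>

text \<open>Contains \<open>n\<close> itself if a coordinate of \<open>n\<close> is 0. This does no harm, as the rate from \<open>n\<close> to \<open>n\<close>
  is 0 in the networks below (\<open>rate_self\<close>).\<close>

definition flow_successors :: "nat ^ 'k::finite \<Rightarrow> (nat ^ 'k) set" where
  "flow_successors n = range (\<lambda>k. n + axis k 1) \<union> range (\<lambda>k. n - axis k 1)"

lemma finite_flow_successors: "finite (flow_successors n)"
  by (simp add: flow_successors_def)

lemma flow_successors_step:
  assumes "v \<in> flow_successors u"
  shows "\<bar>real (v $ k) - real (u $ k)\<bar> \<le> 1"
  using assms by (auto simp: flow_successors_def axis_def)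

lemma sum_flow_rates:
  fixes r :: "'k::finite \<Rightarrow> 'l::finite list"
  shows "(\<Sum>v\<in>flow_successors n. flow_rates C r lam \<mu> a n v * \<phi> v) =
    (\<Sum>k\<in>UNIV. lam $ k * \<phi> (n + axis k 1)) +
    (\<Sum>k\<in>UNIV. \<mu> $ k * throughput C r (a * real_vec n) $ k * \<phi> (n - axis k 1))"
proof -
  let ?V = "flow_successors n"
  have pick: "(\<Sum>v\<in>?V. (\<Sum>k\<in>UNIV. if v = t k then c k else 0) * \<phi> v) = (\<Sum>k\<in>UNIV. c k * \<phi> (t k))"
    if "\<And>k. t k \<in> ?V" for t :: "'k \<Rightarrow> nat ^ 'k" and c :: "'k \<Rightarrow> real"
  proof -
    have "(\<Sum>v\<in>?V. (\<Sum>k\<in>UNIV. if v = t k then c k else 0) * \<phi> v) =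
        (\<Sum>k\<in>UNIV. \<Sum>v\<in>?V. if v = t k then c k * \<phi> v else 0)"
      unfolding sum_distrib_right by (subst sum.swap) (intro sum.cong refl, simp)
    also have "\<dots> = (\<Sum>k\<in>UNIV. c k * \<phi> (t k))"
      using that by (intro sum.cong refl) (simp add: finite_flow_successors)
    finally show ?thesis .
  qed
  have "(\<Sum>v\<in>?V. flow_rates C r lam \<mu> a n v * \<phi> v) =
      (\<Sum>v\<in>?V. (\<Sum>k\<in>UNIV. if v = n + axis k 1 then lam $ k else 0) * \<phi> v) +
      (\<Sum>v\<in>?V. (\<Sum>k\<in>UNIV. if v = n - axis k 1
         then \<mu> $ k * throughput C r (a * real_vec n) $ k else 0) * \<phi> v)"
    unfolding flow_rates_def distrib_right sum.distrib ..
  also have "\<dots> = (\<Sum>k\<in>UNIV. lam $ k * \<phi> (n + axis k 1)) +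
    (\<Sum>k\<in>UNIV. \<mu> $ k * throughput C r (a * real_vec n) $ k * \<phi> (n - axis k 1))"
    by (subst pick, simp add: flow_successors_def, subst pick, simp add: flow_successors_def) simp
  finally show ?thesis .
qed

locale flow_network =
  fixes C :: "real ^ 'l::finite" and r :: "'k::finite \<Rightarrow> 'l list" and lam \<mu> a :: "real ^ 'k"
  assumes acyc: "acyclic_routes r" and C_pos: "\<And>l. 0 < C $ l"
    and lam_pos: "\<And>k. 0 < lam $ k" and \<mu>_pos: "\<And>k. 0 < \<mu> $ k" and a_pos: "\<And>k. 0 < a $ k"
begin

abbreviation psi :: "real ^ 'k \<Rightarrow> real ^ 'k" where "psi \<equiv> throughput C r"

definition input :: "nat ^ 'k \<Rightarrow> real ^ 'k" where "input n = a * real_vec n"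

abbreviation rate :: "nat ^ 'k \<Rightarrow> nat ^ 'k \<Rightarrow> real" where "rate \<equiv> flow_rates C r lam \<mu> a"

text \<open>The right-hand side of the fluid equation. It is also the mean displacement of \<open>input\<close> per unit
  of time, and it does not change when the network is scaled (\<open>drift_scaled\<close>).\<close>

definition drift :: "real ^ 'k \<Rightarrow> real ^ 'k" where
  "drift x = (\<chi> k. a $ k * lam $ k - a $ k * \<mu> $ k * psi x $ k)"

lemma input_nth: "input n $ k = a $ k * real (n $ k)"
  by (simp add: input_def real_vec_def)

lemma input_nonneg: "0 \<le> input n $ k"
  by (simp add: input_nth a_pos less_imp_le)

lemma psi_input_nonneg: "0 \<le> psi (input n) $ k"
  by (rule throughput_nonneg[OF acyc C_pos input_nonneg])

lemma psi_input_empty: "n $ k = 0 \<Longrightarrow> psi (input n) $ k = 0"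
  using throughput_le[OF acyc C_pos input_nonneg, of n k] psi_input_nonneg[of n k]
  by (simp add: input_nth)

lemma rate_nonneg: "0 \<le> rate n v"
  unfolding flow_rates_def using psi_input_nonneg[of n] lam_pos \<mu>_pos
  by (intro add_nonneg_nonneg sum_nonneg) (auto simp: less_imp_le input_def)

lemma rate_self: "rate n n = 0"
proof -
  have 1: "n \<noteq> n + axis k 1" for k by (simp add: vec_eq_iff axis_def)
  have 2: "\<mu> $ k * psi (a * real_vec n) $ k = 0" if "n = n - axis k 1" for k
  proof -
    have "n $ k = (n - axis k 1) $ k" using that by simp
    then have "n $ k = 0" by (simp add: axis_def)
    then show ?thesis using psi_input_empty by (simp add: input_def)
  qed
  show ?thesis unfolding flow_rates_def using 1 2 by (auto intro!: sum.neutral)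
qed

lemma rate_zero_outside:
  assumes "v \<notin> flow_successors n"
  shows "rate n v = 0"
proof -
  have "v \<noteq> n + axis k 1" "v \<noteq> n - axis k 1" for k
    using assms by (auto simp: flow_successors_def)
  then show ?thesis by (simp only: flow_rates_def if_False sum.neutral_const add_0)
qed

lemma exit_rate_sum: "exit_rate rate n = (\<Sum>v\<in>flow_successors n. rate n v)"
proof -
  have "exit_rate rate n = infsum (rate n) (flow_successors n - {n})"
    unfolding exit_rate_def by (rule infsum_cong_neutral) (auto simp: rate_zero_outside)
  also have "\<dots> = (\<Sum>v\<in>flow_successors n - {n}. rate n v)"
    by (simp add: finite_flow_successors)
  also have "\<dots> = (\<Sum>v\<in>flow_successors n. rate n v)"
    by (rule sum.mono_neutral_left) (auto simp: finite_flow_successors rate_self)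
  finally show ?thesis .
qed

lemma exit_rate_eq: "exit_rate rate n = (\<Sum>k\<in>UNIV. lam $ k) + (\<Sum>k\<in>UNIV. \<mu> $ k * psi (input n) $ k)"
  using sum_flow_rates[of C r lam \<mu> a n "\<lambda>_. 1"] by (simp add: exit_rate_sum input_def)

lemma sum_lam_pos: "0 < (\<Sum>k\<in>UNIV. lam $ k)"
  by (rule sum_pos) (auto simp: lam_pos)

lemma exit_rate_ge: "(\<Sum>k\<in>UNIV. lam $ k) \<le> exit_rate rate n"
  unfolding exit_rate_eq using psi_input_nonneg[of n] \<mu>_pos
  by (auto intro!: sum_nonneg simp: less_imp_le)

lemma exit_rate_pos: "0 < exit_rate rate n"
  using exit_rate_ge[of n] sum_lam_pos by simp

lemma jump_prob_eq: "jump_prob rate n v = rate n v / exit_rate rate n"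
  by (simp add: jump_prob_def rate_self)

lemma jump_prob_nonneg: "0 \<le> jump_prob rate n v"
  using rate_nonneg exit_rate_pos[of n] by (simp add: jump_prob_eq)

lemma sum_jump_prob: "(\<Sum>v\<in>flow_successors n. jump_prob rate n v) = 1"
  using exit_rate_pos[of n]
  by (simp add: jump_prob_eq flip: sum_divide_distrib exit_rate_sum)

text \<open>The displacement of the input rate of class \<open>k\<close> in a jump, minus its mean given \<open>u\<close>.\<close>

definition jump_error :: "'k \<Rightarrow> nat ^ 'k \<Rightarrow> nat ^ 'k \<Rightarrow> real" where
  "jump_error k u v = a $ k * (real (v $ k) - real (u $ k)) - drift (input u) $ k / exit_rate rate u"

lemma jump_error_centred:
  "(\<Sum>v\<in>flow_successors u. jump_prob rate u v * jump_error k u v) = 0"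
proof -
  have "(\<Sum>v\<in>flow_successors u. rate u v * (real (v $ k) - real (u $ k))) =
      (\<Sum>j\<in>UNIV. lam $ j * (real ((u + axis j 1) $ k) - real (u $ k))) +
      (\<Sum>j\<in>UNIV. \<mu> $ j * psi (input u) $ j * (real ((u - axis j 1) $ k) - real (u $ k)))"
    by (simp add: sum_flow_rates input_def)
  also have "(\<Sum>j\<in>UNIV. lam $ j * (real ((u + axis j 1) $ k) - real (u $ k))) =
      (\<Sum>j\<in>UNIV. if j = k then lam $ k else 0)"
    by (intro sum.cong refl) (simp add: axis_def)
  also have "\<dots> = lam $ k" by simp
  also have "(\<Sum>j\<in>UNIV. \<mu> $ j * psi (input u) $ j * (real ((u - axis j 1) $ k) - real (u $ k))) =
      (\<Sum>j\<in>UNIV. if j = k then - (\<mu> $ k * psi (input u) $ k) else 0)"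
    using psi_input_empty[of u k] by (intro sum.cong refl) (cases "u $ k", auto simp: axis_def)
  also have "\<dots> = - (\<mu> $ k * psi (input u) $ k)" by simp
  finally have displacement: "(\<Sum>v\<in>flow_successors u. rate u v * (real (v $ k) - real (u $ k))) =
      lam $ k + - (\<mu> $ k * psi (input u) $ k)" .
  have mean: "(\<Sum>v\<in>flow_successors u. a $ k * (rate u v * (real (v $ k) - real (u $ k)))) =
      drift (input u) $ k"
    unfolding sum_distrib_left[symmetric] displacement by (simp add: drift_def algebra_simps)
  have "(\<Sum>v\<in>flow_successors u. jump_prob rate u v * jump_error k u v) =
      (\<Sum>v\<in>flow_successors u. a $ k * (rate u v * (real (v $ k) - real (u $ k)))) / exit_rate rate u -
      (\<Sum>v\<in>flow_successors u. jump_prob rate u v) * (drift (input u) $ k / exit_rate rate u)"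
    unfolding sum_divide_distrib sum_distrib_right sum_subtractf[symmetric]
    by (intro sum.cong refl) (simp add: jump_error_def jump_prob_eq divide_inverse algebra_simps)
  then show ?thesis by (simp add: mean sum_jump_prob)
qed

text \<open>The mean displacement obeys the same bound \<open>a\<^sub>k\<close> as the displacement itself. In the scaled network
  it is of order \<open>1 / \<beta>\<close>, however large the input rates are.\<close>

lemma jump_error_bound:
  assumes "v \<in> flow_successors u"
  shows "\<bar>jump_error k u v\<bar> \<le> 2 * a $ k"
proof -
  let ?q = "exit_rate rate u"
  have "lam $ k \<le> (\<Sum>k\<in>UNIV. lam $ k)"
    by (rule member_le_sum) (auto simp: lam_pos less_imp_le)
  moreover have "\<mu> $ k * psi (input u) $ k \<le> (\<Sum>k\<in>UNIV. \<mu> $ k * psi (input u) $ k)"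
    by (rule member_le_sum) (auto simp: \<mu>_pos less_imp_le psi_input_nonneg)
  moreover have "0 \<le> \<mu> $ k * psi (input u) $ k" "0 \<le> lam $ k"
    using \<mu>_pos[of k] lam_pos[of k] psi_input_nonneg[of u k] by simp_all
  ultimately have "\<bar>lam $ k - \<mu> $ k * psi (input u) $ k\<bar> \<le> ?q"
    unfolding exit_rate_eq by linarith
  then have "a $ k * \<bar>lam $ k - \<mu> $ k * psi (input u) $ k\<bar> \<le> a $ k * ?q"
    using a_pos[of k] by (intro mult_left_mono) auto
  also have "a $ k * \<bar>lam $ k - \<mu> $ k * psi (input u) $ k\<bar> = \<bar>drift (input u) $ k\<bar>"
  proof -
    have "drift (input u) $ k = a $ k * (lam $ k - \<mu> $ k * psi (input u) $ k)"
      by (simp add: drift_def algebra_simps)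
    then show ?thesis using a_pos[of k] by (simp add: abs_mult)
  qed
  finally have "\<bar>drift (input u) $ k / ?q\<bar> \<le> a $ k"
    using exit_rate_pos[of u] by (simp add: abs_divide field_simps)
  moreover have "\<bar>a $ k * (real (v $ k) - real (u $ k))\<bar> \<le> a $ k"
    using mult_left_mono[OF flow_successors_step[OF assms, of k], of "a $ k"] a_pos[of k]
    by (simp add: abs_mult)
  ultimately show ?thesis unfolding jump_error_def by linarith
qed

lemma exit_rate_le:
  assumes "norm (input n) \<le> R"
  shows "exit_rate rate n \<le> (\<Sum>k\<in>UNIV. lam $ k) + (\<Sum>k\<in>UNIV. \<mu> $ k) * R"
proof -
  have "psi (input n) $ k \<le> R" for k
    using throughput_le[OF acyc C_pos input_nonneg, of n k] component_le_norm_cart[of "input n" k] assms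
    by linarith
  then show ?thesis
    unfolding exit_rate_eq sum_distrib_right
    by (intro add_left_mono sum_mono mult_left_mono) (auto simp: \<mu>_pos less_imp_le)
qed

lemma drift_Lipschitz: "\<exists>L. L-lipschitz_on {x. \<forall>k. 0 \<le> x $ k} drift"
proof -
  obtain L where L: "L-lipschitz_on {x. \<forall>k. 0 \<le> x $ k} psi"
    using throughput_Lipschitz[OF acyc C_pos] by blast
  have "((\<Sum>k\<in>UNIV. a $ k * \<mu> $ k) * L)-lipschitz_on {x. \<forall>k. 0 \<le> x $ k} drift"
  proof (rule lipschitz_onI)
    show "0 \<le> (\<Sum>k\<in>UNIV. a $ k * \<mu> $ k) * L"
      using lipschitz_on_nonneg[OF L] a_pos \<mu>_pos by (simp add: sum_nonneg less_imp_le)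
    fix x y :: "real ^ 'k" assume xy: "x \<in> {x. \<forall>k. 0 \<le> x $ k}" "y \<in> {x. \<forall>k. 0 \<le> x $ k}"
    have "dist (drift x) (drift y) \<le> (\<Sum>k\<in>UNIV. \<bar>(drift x - drift y) $ k\<bar>)"
      unfolding dist_norm by (rule norm_le_l1_cart)
    also have "\<dots> \<le> (\<Sum>k\<in>UNIV. a $ k * \<mu> $ k * (L * dist x y))"
    proof (rule sum_mono)
      fix k
      have "(drift x - drift y) $ k = - (a $ k * \<mu> $ k * (psi x - psi y) $ k)"
        by (simp add: drift_def algebra_simps)
      then have "\<bar>(drift x - drift y) $ k\<bar> = a $ k * \<mu> $ k * \<bar>(psi x - psi y) $ k\<bar>"
        using a_pos[of k] \<mu>_pos[of k] by (simp add: abs_mult)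
      also have "\<dots> \<le> a $ k * \<mu> $ k * (L * dist x y)"
        using a_pos[of k] \<mu>_pos[of k] lipschitz_onD[OF L xy]
          component_le_norm_cart[of "psi x - psi y" k]
        by (intro mult_left_mono) (auto simp: dist_norm)
      finally show "\<bar>(drift x - drift y) $ k\<bar> \<le> a $ k * \<mu> $ k * (L * dist x y)" .
    qed
    finally show "dist (drift x) (drift y) \<le> (\<Sum>k\<in>UNIV. a $ k * \<mu> $ k) * L * dist x y"
      by (simp add: sum_distrib_right mult.assoc)
  qed
  then show ?thesis by blast
qed

end

section \<open>Measurability of the deviation\<close>

lemma jump_index_exists:
  fixes s :: "nat \<Rightarrow> real"
  assumes "filterlim (\<lambda>n. \<Sum>m<n. s m) at_top sequentially" "0 \<le> t"
  shows "\<exists>n. (\<Sum>m<n. s m) \<le> t \<and> t < (\<Sum>m<Suc n. s m)"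
proof -
  have "\<exists>n. t < (\<Sum>m<n. s m)"
    using assms(1) unfolding filterlim_at_top_dense by (meson eventually_happens sequentially_bot)
  define n where "n = (LEAST n. t < (\<Sum>m<n. s m))"
  have n: "t < (\<Sum>m<n. s m)" unfolding n_def by (rule LeastI_ex) fact
  then obtain k where k: "n = Suc k" using \<open>0 \<le> t\<close> by (cases n) auto
  have "\<not> t < (\<Sum>m<k. s m)" using not_less_Least[of k "\<lambda>n. t < (\<Sum>m<n. s m)"] k n_def by simp
  then show ?thesis using n k by (intro exI[of _ k]) auto
qed

lemma markov_jump_processE:
  assumes "markov_jump_process M q N"
  obtains Y S where "prob_space M" and "\<And>n. Y n \<in> M \<rightarrow>\<^sub>M count_space UNIV"
    and "\<And>n. S n \<in> borel_measurable M"
    and "\<And>\<omega> m. \<omega> \<in> space M \<Longrightarrow> 0 < S m \<omega>"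
    and "\<And>\<omega>. \<omega> \<in> space M \<Longrightarrow> filterlim (\<lambda>n. \<Sum>m<n. S m \<omega>) at_top sequentially"
    and "\<And>\<omega> n t. \<omega> \<in> space M \<Longrightarrow> (\<Sum>m<n. S m \<omega>) \<le> t \<Longrightarrow> t < (\<Sum>m<Suc n. S m \<omega>) \<Longrightarrow> N t \<omega> = Y n \<omega>"
    and "\<And>n y s. (\<forall>m<n. 0 \<le> s m) \<Longrightarrow>
      measure M {\<omega>\<in>space M. (\<forall>m\<le>n. Y m \<omega> = y m) \<and> (\<forall>m<n. s m < S m \<omega>)} =
      measure M {\<omega>\<in>space M. Y 0 \<omega> = y 0} *
        (\<Prod>m<n. jump_prob q (y m) (y (Suc m)) * exp (- exit_rate q (y m) * s m))"
proof -
  obtain Y S where "prob_space M" and Y: "\<forall>n::nat. Y n \<in> M \<rightarrow>\<^sub>M count_space UNIV"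
    and S: "\<forall>n. S n \<in> borel_measurable M"
    and path: "\<forall>\<omega>\<in>space M. (\<forall>n. 0 < S n \<omega>) \<and>
      filterlim (\<lambda>n. \<Sum>m<n. S m \<omega>) at_top sequentially \<and>
      (\<forall>n. \<forall>t. (\<Sum>m<n. S m \<omega>) \<le> t \<and> t < (\<Sum>m<Suc n. S m \<omega>) \<longrightarrow> N t \<omega> = Y n \<omega>)"
    and law: "\<forall>n y s. (\<forall>m<n. 0 \<le> s m) \<longrightarrow>
      measure M {\<omega>\<in>space M. (\<forall>m\<le>n. Y m \<omega> = y m) \<and> (\<forall>m<n. s m < S m \<omega>)} =
      measure M {\<omega>\<in>space M. Y 0 \<omega> = y 0} *
        (\<Prod>m<n. jump_prob q (y m) (y (Suc m)) * exp (- exit_rate q (y m) * s m))"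
    using assms unfolding markov_jump_process_def by (elim conjE exE, intro that)
  show ?thesis
  proof (rule that[of Y S])
    show "N t \<omega> = Y n \<omega>" if "\<omega> \<in> space M" "(\<Sum>m<n. S m \<omega>) \<le> t" "t < (\<Sum>m<Suc n. S m \<omega>)" for \<omega> n t
      using bspec[OF path that(1)] that(2,3) by blast
    show "measure M {\<omega>\<in>space M. (\<forall>m\<le>n. Y m \<omega> = y m) \<and> (\<forall>m<n. s m < S m \<omega>)} =
        measure M {\<omega>\<in>space M. Y 0 \<omega> = y 0} *
          (\<Prod>m<n. jump_prob q (y m) (y (Suc m)) * exp (- exit_rate q (y m) * s m))"
      if "\<forall>m<n. 0 \<le> s m" for n y s
      using law[THEN spec, THEN spec, THEN spec, THEN mp, OF that] .
  qed (use \<open>prob_space M\<close> Y S path in auto)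
qed

lemma measurable_markov_jump_process:
  assumes "markov_jump_process M q N" "0 \<le> t"
  shows "N t \<in> M \<rightarrow>\<^sub>M count_space UNIV"
proof -
  obtain Y S where M: "prob_space M" and Y [measurable]: "\<And>n. Y n \<in> M \<rightarrow>\<^sub>M count_space UNIV"
    and S [measurable]: "\<And>n. S n \<in> borel_measurable M"
    and S_pos: "\<And>\<omega> m. \<omega> \<in> space M \<Longrightarrow> 0 < S m \<omega>"
    and inf: "\<And>\<omega>. \<omega> \<in> space M \<Longrightarrow> filterlim (\<lambda>n. \<Sum>m<n. S m \<omega>) at_top sequentially"
    and N: "\<And>\<omega> n t. \<omega> \<in> space M \<Longrightarrow> (\<Sum>m<n. S m \<omega>) \<le> t \<Longrightarrow> t < (\<Sum>m<Suc n. S m \<omega>) \<Longrightarrow> N t \<omega> = Y n \<omega>"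
    and law: "\<And>n y s. (\<forall>m<n. 0 \<le> s m) \<Longrightarrow>
      measure M {\<omega>\<in>space M. (\<forall>m\<le>n. Y m \<omega> = y m) \<and> (\<forall>m<n. s m < S m \<omega>)} =
      measure M {\<omega>\<in>space M. Y 0 \<omega> = y 0} *
        (\<Prod>m<n. jump_prob q (y m) (y (Suc m)) * exp (- exit_rate q (y m) * s m))"
    by (rule markov_jump_processE[OF assms(1)], rule that) (assumption | blast)+
  show ?thesis
  proof (subst measurable_count_space_eq2_countable, safe)
    fix y
    have "N t -` {y} \<inter> space M =
        (\<Union>n. {\<omega> \<in> space M. (\<Sum>m<n. S m \<omega>) \<le> t \<and> t < (\<Sum>m<Suc n. S m \<omega>) \<and> Y n \<omega> = y})"
    proof safe
      fix \<omega> assume \<omega>: "\<omega> \<in> space M"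
      then show "\<omega> \<in> (\<Union>n. {x \<in> space M. (\<Sum>m<n. S m x) \<le> t \<and> t < (\<Sum>m<Suc n. S m x) \<and> Y n x = N t \<omega>})"
        using jump_index_exists[OF inf[OF \<omega>] \<open>0 \<le> t\<close>] N[OF \<omega>] by force
    qed (use N in auto)
    also have "\<dots> \<in> sets M" by measurable
    finally show "N t -` {y} \<inter> space M \<in> sets M" .
  qed auto
qed

text \<open>As the deviation is right-continuous in time, its supremum over \<open>[0, T]\<close> is the supremum over
  the rational times and \<open>T\<close>.\<close>

lemma sup_deviation_measurable:
  fixes X :: "real \<Rightarrow> real ^ 'k::finite"
  assumes mjp: "markov_jump_process M q N" and X: "continuous_on {0..} X" and "0 \<le> T"
  shows "sup_deviation a \<beta> N X T \<in> borel_measurable M"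
proof -
  obtain Y S where M: "prob_space M" and Y [measurable]: "\<And>n. Y n \<in> M \<rightarrow>\<^sub>M count_space UNIV"
    and S [measurable]: "\<And>n. S n \<in> borel_measurable M"
    and S_pos: "\<And>\<omega> m. \<omega> \<in> space M \<Longrightarrow> 0 < S m \<omega>"
    and inf: "\<And>\<omega>. \<omega> \<in> space M \<Longrightarrow> filterlim (\<lambda>n. \<Sum>m<n. S m \<omega>) at_top sequentially"
    and N: "\<And>\<omega> n t. \<omega> \<in> space M \<Longrightarrow> (\<Sum>m<n. S m \<omega>) \<le> t \<Longrightarrow> t < (\<Sum>m<Suc n. S m \<omega>) \<Longrightarrow> N t \<omega> = Y n \<omega>"
    and law: "\<And>n y s. (\<forall>m<n. 0 \<le> s m) \<Longrightarrow>
      measure M {\<omega>\<in>space M. (\<forall>m\<le>n. Y m \<omega> = y m) \<and> (\<forall>m<n. s m < S m \<omega>)} =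
      measure M {\<omega>\<in>space M. Y 0 \<omega> = y 0} *
        (\<Prod>m<n. jump_prob q (y m) (y (Suc m)) * exp (- exit_rate q (y m) * s m))"
    by (rule markov_jump_processE[OF mjp], rule that) (assumption | blast)+
  define h where "h n = (1 / real \<beta>) *\<^sub>R (a * real_vec n)" for n
  define dev where "dev t \<omega> = infnorm (h (N t \<omega>) - X t)" for t \<omega>
  define D where "D = ({0..T} \<inter> \<rat>) \<union> {T}"
  have D: "countable D" "D \<subseteq> {0..T}" "D \<noteq> {}"
    using \<open>0 \<le> T\<close> by (auto simp: D_def countable_rat)
  have dev_meas: "dev t \<in> borel_measurable M" if "0 \<le> t" for t
    unfolding dev_def
    by (rule measurable_compose[OF measurable_markov_jump_process[OF mjp that]]) simp
  have bdd: "bdd_above ((\<lambda>t. dev t \<omega>) ` {0..T})" if \<omega>: "\<omega> \<in> space M" for \<omega>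
  proof -
    obtain n where n: "T < (\<Sum>m<n. S m \<omega>)"
      using jump_index_exists[OF inf[OF \<omega>] \<open>0 \<le> T\<close>] by blast
    have "compact (X ` {0..T})"
      by (rule compact_continuous_image[OF continuous_on_subset[OF X]]) auto
    then obtain b where b: "\<And>t. t \<in> {0..T} \<Longrightarrow> norm (X t) \<le> b"
      by (meson bounded_iff compact_imp_bounded image_eqI)
    show ?thesis
    proof (rule bdd_aboveI2)
      fix t assume t: "t \<in> {0..T}"
      then obtain m where m: "(\<Sum>j<m. S j \<omega>) \<le> t" "t < (\<Sum>j<Suc m. S j \<omega>)"
        using jump_index_exists[OF inf[OF \<omega>], of t] by auto
      have "m < n"
      proof (rule ccontr)
        assume "\<not> m < n"
        then have "(\<Sum>j<n. S j \<omega>) \<le> (\<Sum>j<m. S j \<omega>)"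
          using S_pos[OF \<omega>] by (intro sum_mono2) (auto simp: less_imp_le)
        then show False using n m t by simp
      qed
      have "dev t \<omega> \<le> norm (h (N t \<omega>) - X t)" unfolding dev_def by (rule infnorm_le_norm)
      also have "\<dots> \<le> norm (h (N t \<omega>)) + norm (X t)" by (rule norm_triangle_ineq4)
      also have "norm (h (N t \<omega>)) \<le> (\<Sum>j<n. norm (h (Y j \<omega>)))"
        using N[OF \<omega>, of m t] m \<open>m < n\<close> member_le_sum[of m "{..<n}" "\<lambda>j. norm (h (Y j \<omega>))"] by simp
      finally show "dev t \<omega> \<le> (\<Sum>j<n. norm (h (Y j \<omega>))) + b" using b[OF t] by simp
    qed
  qed
  have SUP_eq: "(SUP t\<in>{0..T}. dev t \<omega>) = (SUP t\<in>D. dev t \<omega>)" if \<omega>: "\<omega> \<in> space M" for \<omega>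
  proof (rule antisym)
    show "(SUP t\<in>D. dev t \<omega>) \<le> (SUP t\<in>{0..T}. dev t \<omega>)"
      by (rule cSUP_subset_mono) (use D bdd[OF \<omega>] in auto)
    have bddD: "bdd_above ((\<lambda>t. dev t \<omega>) ` D)"
      by (rule bdd_above_mono[OF bdd[OF \<omega>] image_mono[OF D(2)]])
    show "(SUP t\<in>{0..T}. dev t \<omega>) \<le> (SUP t\<in>D. dev t \<omega>)" (is "_ \<le> ?s")
    proof (rule cSUP_least)
      fix t assume t: "t \<in> {0..T}"
      show "dev t \<omega> \<le> ?s"
      proof (rule ccontr)
        assume less: "\<not> dev t \<omega> \<le> ?s"
        then have "t \<notin> D" using cSUP_upper[OF _ bddD] by blast
        then have "t < T" using t by (auto simp: D_def)
        obtain m where m: "(\<Sum>j<m. S j \<omega>) \<le> t" "t < (\<Sum>j<Suc m. S j \<omega>)"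
          using jump_index_exists[OF inf[OF \<omega>], of t] t by auto
        have "continuous_on {0..} (\<lambda>u. infnorm (h (Y m \<omega>) - X u))"
          by (intro continuous_on_infnorm continuous_intros X)
        moreover have "t \<in> {0..}" "0 < dev t \<omega> - ?s" using t less by auto
        ultimately obtain d where d: "0 < d" "\<And>u. u \<in> {0..} \<Longrightarrow> dist u t < d \<Longrightarrow>
            dist (infnorm (h (Y m \<omega>) - X u)) (infnorm (h (Y m \<omega>) - X t)) < dev t \<omega> - ?s"
          unfolding continuous_on_iff by meson
        obtain u where u: "u \<in> \<rat>" "t < u" "u < min T (min (t + d) (\<Sum>j<Suc m. S j \<omega>))"
          using Rats_dense_in_real[of t "min T (min (t + d) (\<Sum>j<Suc m. S j \<omega>))"] \<open>t < T\<close> d m by auto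
        have "N u \<omega> = Y m \<omega>" "N t \<omega> = Y m \<omega>" using N[OF \<omega>, of m] u m by auto
        then have "dist (dev u \<omega>) (dev t \<omega>) < dev t \<omega> - ?s"
          using d(2)[of u] u t unfolding dev_def by (simp add: dist_real_def)
        then have "?s < dev u \<omega>" by (simp add: dist_real_def)
        moreover have "u \<in> D" using u t by (auto simp: D_def)
        ultimately show False using cSUP_upper[OF _ bddD, of u] by simp
      qed
    qed (use \<open>0 \<le> T\<close> in auto)
  qed
  have "(\<lambda>\<omega>. SUP t\<in>D. dev t \<omega>) \<in> borel_measurable M"
  proof (rule borel_measurable_cSUP[OF D(1)])
    show "dev t \<in> borel_measurable M" if "t \<in> D" for t using dev_meas that D by auto
    show "bdd_above ((\<lambda>t. dev t \<omega>) ` D)" if "\<omega> \<in> space M" for \<omega>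
      by (rule bdd_above_mono[OF bdd[OF that] image_mono[OF D(2)]])
  qed
  then have "(\<lambda>\<omega>. SUP t\<in>{0..T}. dev t \<omega>) \<in> borel_measurable M"
    by (subst measurable_cong[OF SUP_eq])
  then show ?thesis unfolding sup_deviation_def dev_def h_def .
qed

section \<open>The fluid limit\<close>

context flow_network
begin

lemma fluid_solution_iff:
  "fluid_solution C r lam \<mu> a x0 X \<longleftrightarrow> X 0 = x0 \<and> (\<forall>t\<ge>0. X t \<in> {x. \<forall>k. 0 \<le> x $ k}) \<and>
     (\<forall>t\<ge>0. (X has_vector_derivative drift (X t)) (at t within {0..}))"
proof -
  have "(X has_vector_derivative drift (X t)) (at t within {0..}) \<longleftrightarrow>
      (\<forall>k. ((\<lambda>s. X s $ k) has_real_derivative drift (X t) $ k) (at t within {0..}))" for t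
    using has_vector_derivative_vecI[of X "drift (X t)"] has_real_derivative_vecD by blast
  then show ?thesis by (simp add: fluid_solution_def drift_def)
qed

text \<open>The drift is Lipschitz on the nonnegative orthant only. It is extended by composition with the
  positive part; solutions of the extended equation stay nonnegative, because a class whose input
  rate is not positive has throughput 0, hence drift \<open>a\<^sub>k \<lambda>\<^sub>k > 0\<close>.\<close>

lemma fluid_solution_exists:
  assumes "\<And>k. 0 \<le> x0 $ k"
  shows "\<exists>X. fluid_solution C r lam \<mu> a x0 X"
proof -
  define pos :: "real ^ 'k \<Rightarrow> real ^ 'k" where "pos x = (\<chi> k. max 0 (x $ k))" for x
  obtain L where L: "L-lipschitz_on {x. \<forall>k. 0 \<le> x $ k} drift" using drift_Lipschitz by blast
  have "1-lipschitz_on UNIV pos"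
  proof (rule lipschitz_onI)
    fix x y :: "real ^ 'k"
    have "norm (pos x - pos y) \<le> norm (x - y)"
      by (rule norm_le_componentwise_cart) (auto simp: pos_def)
    then show "dist (pos x) (pos y) \<le> 1 * dist x y" by (simp add: dist_norm)
  qed simp
  moreover have "L-lipschitz_on (pos ` UNIV) drift"
    by (rule lipschitz_on_subset[OF L]) (auto simp: pos_def)
  ultimately have "(L * 1)-lipschitz_on UNIV (drift \<circ> pos)" by (rule lipschitz_on_compose)
  from global_solution_exists[OF this, of x0] obtain X where X: "X 0 = x0"
    "\<And>t. 0 \<le> t \<Longrightarrow> (X has_vector_derivative drift (pos (X t))) (at t within {0..})" by auto
  have nonneg: "0 \<le> X t $ k" if "0 \<le> t" for t k
  proof (rule nonneg_if_deriv_pos_when_neg[where u = "\<lambda>t. X t $ k" and u' = "\<lambda>t. drift (pos (X t)) $ k"])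
    show "((\<lambda>t. X t $ k) has_real_derivative drift (pos (X t)) $ k) (at t within {0..})" if "0 \<le> t" for t
      by (rule has_real_derivative_vecD[OF X(2)[OF that]])
    show "0 < drift (pos (X t)) $ k" if "X t $ k < 0" for t
    proof -
      have p: "0 \<le> pos (X t) $ j" for j by (simp add: pos_def)
      have "psi (pos (X t)) $ k \<le> pos (X t) $ k" by (rule throughput_le[OF acyc C_pos p])
      then have "psi (pos (X t)) $ k = 0"
        using throughput_nonneg[OF acyc C_pos p, of k] that by (simp add: pos_def)
      then show ?thesis using a_pos[of k] lam_pos[of k] by (simp add: drift_def)
    qed
  qed (use assms X(1) that in auto)
  then have "pos (X t) = X t" if "0 \<le> t" for t
    using that by (simp add: pos_def vec_eq_iff)
  then show ?thesis
    using X nonneg by (auto simp: fluid_solution_iff)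
qed

lemma fluid_solution_unique:
  assumes "fluid_solution C r lam \<mu> a x0 X" "fluid_solution C r lam \<mu> a x0 X'" "0 \<le> t"
  shows "X' t = X t"
proof -
  obtain L where L: "L-lipschitz_on {x. \<forall>k. 0 \<le> x $ k} drift" using drift_Lipschitz by blast
  show ?thesis
    by (rule solution_unique[OF L, of X' X]) (use assms in \<open>simp_all add: fluid_solution_iff\<close>)
qed

lemma jump_process_representation:
  assumes mjp: "markov_jump_process M rate N" and start: "AE \<omega> in M. N 0 \<omega> = n0"
  shows "\<exists>Y S. jump_process M (jump_prob rate) (exit_rate rate) flow_successors n0 Y S \<and>
    (\<forall>\<omega>\<in>space M. \<forall>n t. (\<Sum>m<n. S m \<omega>) \<le> t \<and> t < (\<Sum>m<Suc n. S m \<omega>) \<longrightarrow> N t \<omega> = Y n \<omega>)"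
proof -
  obtain Y S where M: "prob_space M" and Y [measurable]: "\<And>n. Y n \<in> M \<rightarrow>\<^sub>M count_space UNIV"
    and S [measurable]: "\<And>n. S n \<in> borel_measurable M"
    and S_pos: "\<And>\<omega> m. \<omega> \<in> space M \<Longrightarrow> 0 < S m \<omega>"
    and inf: "\<And>\<omega>. \<omega> \<in> space M \<Longrightarrow> filterlim (\<lambda>n. \<Sum>m<n. S m \<omega>) at_top sequentially"
    and N: "\<And>\<omega> n t. \<omega> \<in> space M \<Longrightarrow> (\<Sum>m<n. S m \<omega>) \<le> t \<Longrightarrow> t < (\<Sum>m<Suc n. S m \<omega>) \<Longrightarrow> N t \<omega> = Y n \<omega>"
    and law: "\<And>n y s. (\<forall>m<n. 0 \<le> s m) \<Longrightarrow>
      measure M {\<omega>\<in>space M. (\<forall>m\<le>n. Y m \<omega> = y m) \<and> (\<forall>m<n. s m < S m \<omega>)} =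
      measure M {\<omega>\<in>space M. Y 0 \<omega> = y 0} *
        (\<Prod>m<n. jump_prob rate (y m) (y (Suc m)) * exp (- exit_rate rate (y m) * s m))"
    by (rule markov_jump_processE[OF mjp], rule that) (assumption | blast)+
  interpret prob_space M by (rule M)
  have "AE \<omega> in M. Y 0 \<omega> = n0"
  proof (rule AE_mp[OF start AE_I2], rule impI)
    fix \<omega> assume \<omega>: "\<omega> \<in> space M" "N 0 \<omega> = n0"
    have "N 0 \<omega> = Y 0 \<omega>" using N[OF \<omega>(1), of 0 0] S_pos[OF \<omega>(1), of 0] by simp
    then show "Y 0 \<omega> = n0" using \<omega> by simp
  qed
  then have "jump_process M (jump_prob rate) (exit_rate rate) flow_successors n0 Y S"
    by unfold_locales (rule Y S S_pos law jump_prob_nonneg sum_jump_prob exit_rate_pos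
        finite_flow_successors | assumption)+
  then show ?thesis using N by (intro exI[of _ Y] exI[of _ S] conjI ballI allI impI) auto
qed

text \<open>The accumulated jump errors are the perturbations of the jump chain as an Euler scheme whose
  steps are the mean holding times.\<close>

lemma sum_jump_error:
  "(\<Sum>m<n. jump_error k (y m) (y (Suc m))) =
    (input (y n) - input (y 0) - (\<Sum>m<n. (1 / exit_rate rate (y m)) *\<^sub>R drift (input (y m)))) $ k"
  by (induction n) (simp_all add: jump_error_def input_nth algebra_simps)

lemma scaled_flow_network:
  assumes "1 \<le> \<beta>"
  shows "flow_network C r (real \<beta> *\<^sub>R lam) (real \<beta> *\<^sub>R \<mu>) ((1 / real \<beta>) *\<^sub>R a)"
  by unfold_locales (use assms in \<open>simp_all add: acyc C_pos lam_pos \<mu>_pos a_pos\<close>)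

lemma drift_scaled:
  assumes "1 \<le> \<beta>"
  shows "flow_network.drift C r (real \<beta> *\<^sub>R lam) (real \<beta> *\<^sub>R \<mu>) ((1 / real \<beta>) *\<^sub>R a) = drift"
  unfolding flow_network.drift_def[OF scaled_flow_network[OF assms]] drift_def
  using assms by (simp add: fun_eq_iff)

text \<open>Off an event of vanishing probability the perturbations and the clock error are small up to
  the first \<open>A \<beta>\<close> jumps; there, the deterministic comparison \<open>jump_path_near_solution\<close> applies.\<close>

lemma fluid_limit_in_probability:
  fixes M :: "nat \<Rightarrow> 'w measure" and N :: "nat \<Rightarrow> real \<Rightarrow> 'w \<Rightarrow> nat ^ 'k" and n0 :: "nat \<Rightarrow> nat ^ 'k"
  assumes mjp: "\<And>\<beta>. 1 \<le> \<beta> \<Longrightarrow> markov_jump_process (M \<beta>) (scaled_flow_rates C r lam \<mu> a \<beta>) (N \<beta>)"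
    and start: "\<And>\<beta>. 1 \<le> \<beta> \<Longrightarrow> AE \<omega> in M \<beta>. N \<beta> 0 \<omega> = n0 \<beta>"
    and conv: "(\<lambda>\<beta>. (1 / real \<beta>) *\<^sub>R (a * real_vec (n0 \<beta>))) \<longlonglongrightarrow> x0"
    and X: "fluid_solution C r lam \<mu> a x0 X"
    and "0 < T" "0 < \<epsilon>"
  shows "(\<lambda>\<beta>. measure (M \<beta>) {\<omega> \<in> space (M \<beta>). \<epsilon> \<le> sup_deviation a \<beta> (N \<beta>) X T \<omega>}) \<longlonglongrightarrow> 0"
proof -
  let ?S = "{x::real ^ 'k. \<forall>k. 0 \<le> x $ k}"
  define Q where "Q \<beta> = scaled_flow_rates C r lam \<mu> a \<beta>" for \<beta>
  define q where "q \<beta> n = exit_rate (Q \<beta>) n" for \<beta> n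
  define z where "z \<beta> n = (1 / real \<beta>) *\<^sub>R (a * real_vec n)" for \<beta> and n :: "nat ^ 'k"
  have Q: "flow_rates C r (real \<beta> *\<^sub>R lam) (real \<beta> *\<^sub>R \<mu>) ((1 / real \<beta>) *\<^sub>R a) = Q \<beta>" for \<beta>
    by (simp add: Q_def scaled_flow_rates_def)
  have zinput: "flow_network.input ((1 / real \<beta>) *\<^sub>R a) n = z \<beta> n" if "1 \<le> \<beta>" for \<beta> n
    by (simp add: flow_network.input_def[OF scaled_flow_network[OF that]] z_def)

  have "\<forall>\<beta>. \<exists>Y S. 1 \<le> \<beta> \<longrightarrow>
      jump_process (M \<beta>) (jump_prob (Q \<beta>)) (q \<beta>) flow_successors (n0 \<beta>) Y S \<and>
      (\<forall>\<omega>\<in>space (M \<beta>). \<forall>n t. (\<Sum>m<n. S m \<omega>) \<le> t \<and> t < (\<Sum>m<Suc n. S m \<omega>) \<longrightarrow> N \<beta> t \<omega> = Y n \<omega>)"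
  proof
    fix \<beta>
    show "\<exists>Y S. 1 \<le> \<beta> \<longrightarrow>
      jump_process (M \<beta>) (jump_prob (Q \<beta>)) (q \<beta>) flow_successors (n0 \<beta>) Y S \<and>
      (\<forall>\<omega>\<in>space (M \<beta>). \<forall>n t. (\<Sum>m<n. S m \<omega>) \<le> t \<and> t < (\<Sum>m<Suc n. S m \<omega>) \<longrightarrow> N \<beta> t \<omega> = Y n \<omega>)"
    proof (cases "1 \<le> \<beta>")
      case True
      have "markov_jump_process (M \<beta>) (Q \<beta>) (N \<beta>)" using mjp[OF True] by (simp add: Q_def)
      from flow_network.jump_process_representation[OF scaled_flow_network[OF True], unfolded Q,
          OF this start[OF True]]
      show ?thesis unfolding q_def[abs_def] by blast
    qed simp
  qed
  then obtain Y S where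
    JP: "\<And>\<beta>. 1 \<le> \<beta> \<Longrightarrow> jump_process (M \<beta>) (jump_prob (Q \<beta>)) (q \<beta>) flow_successors (n0 \<beta>) (Y \<beta>) (S \<beta>)"
    and path: "\<And>\<beta> \<omega> n t. 1 \<le> \<beta> \<Longrightarrow> \<omega> \<in> space (M \<beta>) \<Longrightarrow> (\<Sum>m<n. S \<beta> m \<omega>) \<le> t \<Longrightarrow>
        t < (\<Sum>m<Suc n. S \<beta> m \<omega>) \<Longrightarrow> N \<beta> t \<omega> = Y \<beta> n \<omega>"
    by metis
  have P: "prob_space (M \<beta>)" if "1 \<le> \<beta>" for \<beta>
    using JP[OF that] by (simp add: jump_process_def)

  \<comment> \<open>\<open>V k\<close> is the martingale of the accumulated jump errors of class \<open>k\<close>, and \<open>W\<close> the one that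
    compares the true time with the sum of the mean holding times. Both fall by at most a constant
    over \<open>\<beta>\<close> in a step, so their maxima over the first \<open>A \<beta>\<close> jumps vanish in the limit.\<close>
  define je where "je \<beta> = flow_network.jump_error C r (real \<beta> *\<^sub>R lam) (real \<beta> *\<^sub>R \<mu>) ((1 / real \<beta>) *\<^sub>R a)" for \<beta>
  define V where "V k \<beta> n \<omega> = (\<Sum>m<n. je \<beta> k (Y \<beta> m \<omega>) (Y \<beta> (Suc m) \<omega>))" for k \<beta> n \<omega>
  define W where "W \<beta> n \<omega> = (\<Sum>m<n. S \<beta> m \<omega> - 1 / q \<beta> (Y \<beta> m \<omega>))" for \<beta> n \<omega>
  define \<kappa>0 where "\<kappa>0 = 1 / (\<Sum>k\<in>UNIV. lam $ k)"
  have \<kappa>0: "0 < \<kappa>0" using sum_lam_pos by (simp add: \<kappa>0_def)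
  have q_pos: "0 < q \<beta> n" if "1 \<le> \<beta>" for \<beta> n
    using flow_network.exit_rate_pos[OF scaled_flow_network[OF that], of n] by (simp add: Q q_def)
  have q_ge: "1 / q \<beta> n \<le> \<kappa>0 / real \<beta>" if "1 \<le> \<beta>" for \<beta> n
  proof -
    have "real \<beta> * (\<Sum>k\<in>UNIV. lam $ k) \<le> q \<beta> n"
      using flow_network.exit_rate_ge[OF scaled_flow_network[OF that], of n]
      by (simp add: Q q_def sum_distrib_left)
    then have "1 / q \<beta> n \<le> 1 / (real \<beta> * (\<Sum>k\<in>UNIV. lam $ k))"
      using sum_lam_pos that by (intro divide_left_mono) (auto intro!: mult_pos_pos q_pos)
    then show ?thesis by (simp add: \<kappa>0_def mult.commute)
  qed
  have V_to_0: "(\<lambda>\<beta>. measure (M \<beta>) {\<omega> \<in> space (M \<beta>). \<exists>n\<le>nat \<lceil>A * real \<beta>\<rceil>. \<delta> < \<bar>V k \<beta> n \<omega>\<bar>}) \<longlonglongrightarrow> 0"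
    if "0 < \<delta>" "0 \<le> A" for k \<delta> A
  proof (rule prob_max_tendsto_0[where \<kappa> = "2 * a $ k"])
    fix \<beta> :: nat assume \<beta>: "1 \<le> \<beta>"
    interpret jump_process "M \<beta>" "jump_prob (Q \<beta>)" "q \<beta>" flow_successors "n0 \<beta>" "Y \<beta>" "S \<beta>"
      by (rule JP[OF \<beta>])
    have bound: "\<bar>je \<beta> k u v\<bar> \<le> 2 * a $ k / real \<beta>" if "v \<in> flow_successors u" for u v
      using flow_network.jump_error_bound[OF scaled_flow_network[OF \<beta>] that, of k] by (simp add: je_def)
    have centred: "(\<Sum>v\<in>flow_successors u. jump_prob (Q \<beta>) u v * je \<beta> k u v) = 0" for u
      using flow_network.jump_error_centred[OF scaled_flow_network[OF \<beta>], of u k]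
      by (simp add: je_def Q)
    show "V k \<beta> n \<in> borel_measurable (M \<beta>)" for n
      unfolding V_def by (rule measurable_step_sum)
    show "(\<integral>\<^sup>+ \<omega>. ennreal ((V k \<beta> n \<omega>)\<^sup>2) \<partial>M \<beta>) \<le> ennreal (real n * (2 * a $ k / real \<beta>)\<^sup>2)" for n
      unfolding V_def by (rule chain_second_moment[OF bound centred])
    show "AE \<omega> in M \<beta>. \<forall>n. V k \<beta> n \<omega> - 2 * a $ k / real \<beta> \<le> V k \<beta> (Suc n) \<omega>"
      using AE_succs
    proof eventually_elim
      case (elim \<omega>)
      show ?case
      proof
        fix n
        show "V k \<beta> n \<omega> - 2 * a $ k / real \<beta> \<le> V k \<beta> (Suc n) \<omega>"
          using bound[OF elim[rule_format, of n]] by (simp add: V_def abs_le_iff)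
      qed
    qed
  qed (use that P a_pos in auto)
  have W_to_0: "(\<lambda>\<beta>. measure (M \<beta>) {\<omega> \<in> space (M \<beta>). \<exists>n\<le>nat \<lceil>A * real \<beta>\<rceil>. \<delta> < \<bar>W \<beta> n \<omega>\<bar>}) \<longlonglongrightarrow> 0"
    if "0 < \<delta>" "0 \<le> A" for \<delta> A
  proof (rule prob_max_tendsto_0[where \<kappa> = \<kappa>0])
    fix \<beta> :: nat assume \<beta>: "1 \<le> \<beta>"
    interpret jump_process "M \<beta>" "jump_prob (Q \<beta>)" "q \<beta>" flow_successors "n0 \<beta>" "Y \<beta>" "S \<beta>"
      by (rule JP[OF \<beta>])
    show "W \<beta> n \<in> borel_measurable (M \<beta>)" for n
      unfolding W_def by (rule measurable_clock_error)
    show "(\<integral>\<^sup>+ \<omega>. ennreal ((W \<beta> n \<omega>)\<^sup>2) \<partial>M \<beta>) \<le> ennreal (real n * (\<kappa>0 / real \<beta>)\<^sup>2)" for n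
      unfolding W_def by (rule clock_second_moment[OF q_ge[OF \<beta>]])
    show "AE \<omega> in M \<beta>. \<forall>n. W \<beta> n \<omega> - \<kappa>0 / real \<beta> \<le> W \<beta> (Suc n) \<omega>"
    proof (rule AE_I2, rule allI)
      fix \<omega> n assume "\<omega> \<in> space (M \<beta>)"
      then show "W \<beta> n \<omega> - \<kappa>0 / real \<beta> \<le> W \<beta> (Suc n) \<omega>"
        using S_pos[of \<omega> n] q_ge[OF \<beta>, of "Y \<beta> n \<omega>"] by (simp add: W_def)
    qed
  qed (use that P \<kappa>0 in auto)

  \<comment> \<open>The horizon exceeds \<open>T\<close>, as the clock of the mean holding times may be ahead of time by \<open>\<delta> < 1\<close>.\<close>
  define H where "H = T + 1"
  obtain L where L: "L-lipschitz_on ?S drift" using drift_Lipschitz by blast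
  have X0: "X 0 = x0" and X_in: "\<And>t. 0 \<le> t \<Longrightarrow> X t \<in> ?S"
    and X_deriv: "\<And>t. 0 \<le> t \<Longrightarrow> (X has_vector_derivative drift (X t)) (at t within {0..})"
    using X by (auto simp: fluid_solution_iff)
  have X_cont: "continuous_on {0..} X"
    using has_vector_derivative_continuous[OF X_deriv] by (simp add: continuous_on_eq_continuous_within)
  have "bounded (X ` {0..H})"
    by (rule compact_imp_bounded, rule compact_continuous_image[OF continuous_on_subset[OF X_cont]]) auto
  then obtain R where "\<forall>y\<in>X ` {0..H}. norm y \<le> R"
    unfolding bounded_iff by blast
  then have R: "norm (X t) \<le> R" if "0 \<le> t" "t \<le> H" for t using that by simp
  have R0: "0 \<le> R" using order_trans[OF norm_ge_zero R[of 0]] \<open>0 < T\<close> by (simp add: H_def)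
  have L0: "0 \<le> L" using lipschitz_on_nonneg[OF L] .
  define B where "B = norm (drift x0) + L * (2 * R)"
  have B0: "0 \<le> B" using L0 R0 by (simp add: B_def)
  have speed: "norm (drift (X t)) \<le> B" if t: "0 \<le> t" "t \<le> H" for t
  proof -
    have "norm (drift (X t)) \<le> norm (drift (X 0)) + norm (drift (X t) - drift (X 0))"
      by (rule norm_triangle_sub)
    also have "norm (drift (X t) - drift (X 0)) \<le> L * norm (X t - X 0)"
      by (rule lipschitz_on_normD[OF L X_in X_in]) (use t in auto)
    also have "norm (X t - X 0) \<le> 2 * R"
      using norm_triangle_ineq4[of "X t" "X 0"] R[OF t] R[of 0] t by simp
    finally show ?thesis using L0 by (simp add: B_def X0 mult_left_mono)
  qed
  interpret flow: lipschitz_flow drift ?S L X H B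
    by unfold_locales (use L X_in X_deriv speed B0 in auto)
  define \<Lambda> where "\<Lambda> = (\<Sum>k\<in>UNIV. lam $ k) + (\<Sum>k\<in>UNIV. \<mu> $ k) * (R + 1)"
  have \<Lambda>: "0 < \<Lambda>"
    using sum_lam_pos R0 \<mu>_pos by (simp add: \<Lambda>_def add_pos_nonneg sum_nonneg less_imp_le)
  have slow: "1 / (real \<beta> * \<Lambda>) \<le> 1 / q \<beta> n"
    if \<beta>: "1 \<le> \<beta>" and u: "0 \<le> u" "u \<le> H" "norm (z \<beta> n - X u) \<le> 1" for \<beta> n u
  proof -
    have "norm (z \<beta> n) \<le> R + 1"
      using norm_triangle_sub[of "z \<beta> n" "X u"] R[OF u(1,2)] u(3) by simp
    then have "q \<beta> n \<le> real \<beta> * \<Lambda>"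
      using flow_network.exit_rate_le[OF scaled_flow_network[OF \<beta>], of n "R + 1"] zinput[OF \<beta>]
      by (simp add: Q q_def \<Lambda>_def sum_distrib_left sum_distrib_right distrib_left mult.assoc)
    then show ?thesis using q_pos[OF \<beta>, of n] by (intro divide_left_mono) (auto intro!: mult_pos_pos)
  qed
  \<comment> \<open>Half of \<open>\<epsilon> / 2\<close> is for the error \<open>\<eta>\<close> of the Euler scheme, a third of which each is due to the
    initial state, the perturbations and the step length; the other half is for the change of clock.\<close>
  define \<eta> where "\<eta> = min (\<epsilon> / 4) 1"
  define \<eta>0 where "\<eta>0 = \<eta> / (3 * exp (L * H))"
  have \<eta>: "0 < \<eta>" "\<eta> \<le> 1" "\<eta> \<le> \<epsilon> / 4" using \<open>0 < \<epsilon>\<close> by (auto simp: \<eta>_def)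
  have \<eta>0: "0 < \<eta>0" "3 * \<eta>0 * exp (L * H) = \<eta>" using \<eta> by (simp_all add: \<eta>0_def)
  define \<rho> where "\<rho> = \<epsilon> / (8 * (B + 1))"
  have \<rho>: "0 < \<rho>" "B * (2 * \<rho>) \<le> \<epsilon> / 4"
    using B0 \<open>0 < \<epsilon>\<close> by (simp_all add: \<rho>_def field_simps)
  define \<delta> where "\<delta> = min (min \<eta>0 (1 / 2)) (\<rho>)"
  have \<delta>: "0 < \<delta>" "\<delta> \<le> \<eta>0" "\<delta> < 1" "\<delta> \<le> \<rho>"
    using \<eta>0 \<rho> by (auto simp: \<delta>_def)
  define \<delta>' where "\<delta>' = \<delta> / real CARD('k)"
  have \<delta>': "0 < \<delta>'" "real CARD('k) * \<delta>' = \<delta>" using \<delta> by (simp_all add: \<delta>'_def)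
  define A where "A = \<Lambda> * H"
  have A: "0 \<le> A" using \<Lambda> \<open>0 < T\<close> by (simp add: A_def H_def)
  define badV where "badV k \<beta> = {\<omega> \<in> space (M \<beta>). \<exists>n\<le>nat \<lceil>A * real \<beta>\<rceil>. \<delta>' < \<bar>V k \<beta> n \<omega>\<bar>}" for k \<beta>
  define badW where "badW \<beta> = {\<omega> \<in> space (M \<beta>). \<exists>n\<le>nat \<lceil>A * real \<beta>\<rceil>. \<delta> < \<bar>W \<beta> n \<omega>\<bar>}" for \<beta>

  have good: "sup_deviation a \<beta> (N \<beta>) X T \<omega> \<le> \<epsilon> / 2"
    if \<beta>: "1 \<le> \<beta>" and init: "norm (z \<beta> (n0 \<beta>) - x0) \<le> \<eta>0"
      and small: "L * B * (\<kappa>0 / real \<beta>) * H \<le> \<eta>0" "\<kappa>0 / real \<beta> \<le> \<rho>"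
      and \<omega>: "\<omega> \<in> space (M \<beta>)" "Y \<beta> 0 \<omega> = n0 \<beta>" "\<forall>k. \<omega> \<notin> badV k \<beta>" "\<omega> \<notin> badW \<beta>"
    for \<beta> \<omega>
  proof -
    define Z where "Z m = z \<beta> (Y \<beta> m \<omega>)" for m
    define \<theta> where "\<theta> m = 1 / q \<beta> (Y \<beta> m \<omega>)" for m
    have \<theta>: "0 \<le> \<theta> m" "\<theta> m \<le> \<kappa>0 / real \<beta>" for m
      using q_pos[OF \<beta>] q_ge[OF \<beta>] by (simp_all add: \<theta>_def less_imp_le)
    have V_small: "\<bar>V k \<beta> n \<omega>\<bar> \<le> \<delta>'" if "n \<le> nat \<lceil>A * real \<beta>\<rceil>" for k n
      using \<omega>(1,3) that by (force simp: badV_def not_less)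
    have W_small: "\<bar>W \<beta> n \<omega>\<bar> \<le> \<delta>" if "n \<le> nat \<lceil>A * real \<beta>\<rceil>" for n
      using \<omega>(1,4) that by (force simp: badW_def not_less)
    have dev: "infnorm ((1 / real \<beta>) *\<^sub>R (a * real_vec (N \<beta> t \<omega>)) - X t) \<le> \<epsilon> / 2"
      if t: "t \<in> {0..T}" for t
    proof -
      have "norm (z \<beta> (N \<beta> t \<omega>) - X t) \<le> \<eta> + B * (\<delta> + \<kappa>0 / real \<beta>)"
      proof (rule flow.jump_path_near_solution[where Z = Z and \<theta> = \<theta> and s = "\<lambda>m. S \<beta> m \<omega>"
            and \<Lambda> = "real \<beta> * \<Lambda>" and ?n1.0 = "nat \<lceil>A * real \<beta>\<rceil>"])
        show "Z m \<in> ?S" for m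
          using flow_network.input_nonneg[OF scaled_flow_network[OF \<beta>]] zinput[OF \<beta>] by (simp add: Z_def)
        show "norm (Z m - Z 0 - (\<Sum>j<m. \<theta> j *\<^sub>R drift (Z j))) \<le> \<delta>" if m: "m \<le> nat \<lceil>A * real \<beta>\<rceil>" for m
        proof -
          have "(Z m - Z 0 - (\<Sum>j<m. \<theta> j *\<^sub>R drift (Z j))) $ k = V k \<beta> m \<omega>" for k
            using flow_network.sum_jump_error[OF scaled_flow_network[OF \<beta>], of k "\<lambda>m. Y \<beta> m \<omega>" m]
            by (simp only: V_def je_def Z_def \<theta>_def Q q_def zinput[OF \<beta>] drift_scaled[OF \<beta>])
          then have "norm (Z m - Z 0 - (\<Sum>j<m. \<theta> j *\<^sub>R drift (Z j))) \<le> (\<Sum>k\<in>UNIV. \<bar>V k \<beta> m \<omega>\<bar>)"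
            using norm_le_l1_cart[of "Z m - Z 0 - (\<Sum>j<m. \<theta> j *\<^sub>R drift (Z j))"] by simp
          also have "\<dots> \<le> (\<Sum>k\<in>(UNIV::'k set). \<delta>')" by (intro sum_mono V_small m)
          finally show ?thesis using \<delta>' by simp
        qed
        show "\<bar>(\<Sum>j<m. S \<beta> j \<omega>) - (\<Sum>j<m. \<theta> j)\<bar> \<le> \<delta>" if "m \<le> nat \<lceil>A * real \<beta>\<rceil>" for m
          using W_small[OF that] by (simp add: W_def \<theta>_def sum_subtractf)
        show "1 / (real \<beta> * \<Lambda>) \<le> \<theta> m" if "0 \<le> u" "u \<le> H" "norm (Z m - X u) \<le> 1" for m u
          using slow[OF \<beta> that(1,2)] that(3) by (simp add: \<theta>_def Z_def)
        show "0 < real \<beta> * \<Lambda>" using \<beta> \<Lambda> by simp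
        show "real \<beta> * \<Lambda> * H \<le> real (nat \<lceil>A * real \<beta>\<rceil>)"
          unfolding A_def using real_nat_ceiling_ge[of "\<Lambda> * H * real \<beta>"] by (simp add: mult_ac)
        have "norm (Z 0 - X 0) + \<delta> + L * B * (\<kappa>0 / real \<beta>) * H \<le> 3 * \<eta>0"
          using init small(1) \<delta>(2) \<omega>(2) by (simp add: Z_def X0)
        then have "(norm (Z 0 - X 0) + \<delta> + L * B * (\<kappa>0 / real \<beta>) * H) * exp (L * H) \<le> 3 * \<eta>0 * exp (L * H)"
          by (rule mult_right_mono) simp
        then show "(norm (Z 0 - X 0) + \<delta> + L * B * (\<kappa>0 / real \<beta>) * H) * exp (L * H) \<le> \<eta>"
          using \<eta>0 by simp
        show "z \<beta> (N \<beta> t \<omega>) = Z n" if "(\<Sum>j<n. S \<beta> j \<omega>) \<le> t" "t < (\<Sum>j<Suc n. S \<beta> j \<omega>)" for n t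
          using path[OF \<beta> \<omega>(1) that] by (simp add: Z_def)
      qed (use \<theta> \<eta> t \<delta> in \<open>auto simp: H_def\<close>)
      also have "\<dots> \<le> \<epsilon> / 4 + \<epsilon> / 4"
      proof (rule add_mono)
        have "B * (\<delta> + \<kappa>0 / real \<beta>) \<le> B * (2 * \<rho>)"
          using \<delta>(4) small(2) B0 by (intro mult_left_mono) auto
        also have "\<dots> \<le> \<epsilon> / 4" by (rule \<rho>(2))
        finally show "B * (\<delta> + \<kappa>0 / real \<beta>) \<le> \<epsilon> / 4" by simp
      qed (rule \<eta>(3))
      finally show ?thesis
        using infnorm_le_norm[of "z \<beta> (N \<beta> t \<omega>) - X t"] by (simp add: z_def)
    qed
    show ?thesis
      unfolding sup_deviation_def by (rule cSUP_least) (use dev \<open>0 < T\<close> in auto)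
  qed

  have "\<forall>\<^sub>F \<beta> in sequentially. norm (z \<beta> (n0 \<beta>) - x0) < \<eta>0"
    using tendstoD[OF conv \<eta>0(1)] by (simp add: z_def dist_norm)
  moreover have "(\<lambda>\<beta>. L * B * (\<kappa>0 / real \<beta>) * H) \<longlonglongrightarrow> L * B * 0 * H"
    by (intro tendsto_intros lim_const_over_n)
  then have "\<forall>\<^sub>F \<beta> in sequentially. L * B * (\<kappa>0 / real \<beta>) * H < \<eta>0"
    using \<eta>0 by (intro order_tendstoD(2)) auto
  moreover have "\<forall>\<^sub>F \<beta> in sequentially. \<kappa>0 / real \<beta> < \<rho>"
    using \<rho> by (intro order_tendstoD(2)[OF lim_const_over_n]) auto
  moreover have "\<forall>\<^sub>F \<beta> in sequentially. (1::nat) \<le> \<beta>" by (rule eventually_ge_at_top)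
  ultimately have le: "\<forall>\<^sub>F \<beta> in sequentially.
      measure (M \<beta>) {\<omega> \<in> space (M \<beta>). \<epsilon> \<le> sup_deviation a \<beta> (N \<beta>) X T \<omega>} \<le>
      (\<Sum>k\<in>UNIV. measure (M \<beta>) (badV k \<beta>)) + measure (M \<beta>) (badW \<beta>)"
  proof eventually_elim
    case (elim \<beta>)
    note \<beta> = elim(4)
    interpret jump_process "M \<beta>" "jump_prob (Q \<beta>)" "q \<beta>" flow_successors "n0 \<beta>" "Y \<beta>" "S \<beta>"
      by (rule JP[OF \<beta>])
    have [measurable]: "V k \<beta> n \<in> borel_measurable (M \<beta>)" "W \<beta> n \<in> borel_measurable (M \<beta>)" for k n
      unfolding V_def W_def by (rule measurable_step_sum measurable_clock_error)+
    have [measurable]: "badV k \<beta> \<in> sets (M \<beta>)" "badW \<beta> \<in> sets (M \<beta>)" for k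
      unfolding badV_def badW_def by measurable
    have "prob {\<omega> \<in> space (M \<beta>). \<epsilon> \<le> sup_deviation a \<beta> (N \<beta>) X T \<omega>} \<le>
        prob ((\<Union>k\<in>UNIV. badV k \<beta>) \<union> badW \<beta>)"
    proof (rule finite_measure_mono_AE)
      show "AE \<omega> in M \<beta>. \<omega> \<in> {\<omega> \<in> space (M \<beta>). \<epsilon> \<le> sup_deviation a \<beta> (N \<beta>) X T \<omega>} \<longrightarrow>
          \<omega> \<in> (\<Union>k\<in>UNIV. badV k \<beta>) \<union> badW \<beta>"
        using start
      proof eventually_elim
        case (elim \<omega>)
        show ?case
        proof (intro impI, rule ccontr)
          assume "\<omega> \<in> {\<omega> \<in> space (M \<beta>). \<epsilon> \<le> sup_deviation a \<beta> (N \<beta>) X T \<omega>}"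
            "\<omega> \<notin> (\<Union>k\<in>UNIV. badV k \<beta>) \<union> badW \<beta>"
          then show False
            using good[OF \<beta>, of \<omega>] elim \<open>norm (z \<beta> (n0 \<beta>) - x0) < \<eta>0\<close>
              \<open>L * B * (\<kappa>0 / real \<beta>) * H < \<eta>0\<close> \<open>\<kappa>0 / real \<beta> < \<rho>\<close> \<open>0 < \<epsilon>\<close> by auto
        qed
      qed
    qed auto
    also have "\<dots> \<le> prob (\<Union>k\<in>UNIV. badV k \<beta>) + prob (badW \<beta>)"
      by (rule measure_Un_le) auto
    also have "prob (\<Union>k\<in>UNIV. badV k \<beta>) \<le> (\<Sum>k\<in>UNIV. prob (badV k \<beta>))"
      by (rule finite_measure_subadditive_finite) auto
    finally show ?case by simp
  qed
  have "(\<lambda>\<beta>. (\<Sum>k\<in>UNIV. measure (M \<beta>) (badV k \<beta>)) + measure (M \<beta>) (badW \<beta>)) \<longlonglongrightarrow>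
      (\<Sum>k\<in>(UNIV::'k set). 0) + 0"
    unfolding badV_def badW_def
    by (intro tendsto_add tendsto_sum V_to_0 W_to_0 \<delta>'(1) \<delta>(1) A)
  then have lim: "(\<lambda>\<beta>. (\<Sum>k\<in>UNIV. measure (M \<beta>) (badV k \<beta>)) + measure (M \<beta>) (badW \<beta>)) \<longlonglongrightarrow> 0"
    by simp
  show ?thesis
    by (rule real_tendsto_sandwich[OF _ le tendsto_const lim]) simp
qed

end

theorem theorem3:
  fixes C :: "real ^ 'l::finite"
    and r :: "'k::finite \<Rightarrow> 'l list"
    and lam \<mu> a x0 :: "real ^ 'k"
    and n0 :: "nat \<Rightarrow> nat ^ 'k"
    and M :: "nat \<Rightarrow> 'w measure"
    and N :: "nat \<Rightarrow> real \<Rightarrow> 'w \<Rightarrow> nat ^ 'k"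
  assumes "\<And>l. 0 < C $ l"
    and "\<And>k. 0 < lam $ k" and "\<And>k. 0 < \<mu> $ k" and "\<And>k. 0 < a $ k"
    and "\<And>k. distinct (r k)"
    and "acyclic_routes r"
    and "\<And>\<beta>. 1 \<le> \<beta> \<Longrightarrow> markov_jump_process (M \<beta>) (scaled_flow_rates C r lam \<mu> a \<beta>) (N \<beta>)"
    and "\<And>\<beta>. 1 \<le> \<beta> \<Longrightarrow> AE \<omega> in M \<beta>. N \<beta> 0 \<omega> = n0 \<beta>"
    and "\<And>k. 0 \<le> x0 $ k"
    and "(\<lambda>\<beta>. (1 / real \<beta>) *\<^sub>R (a * real_vec (n0 \<beta>))) \<longlonglongrightarrow> x0"
  shows "\<exists>X. fluid_solution C r lam \<mu> a x0 X \<and>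
           (\<forall>X'. fluid_solution C r lam \<mu> a x0 X' \<longrightarrow> (\<forall>t\<ge>0. X' t = X t)) \<and>
           (\<forall>T>0. \<forall>\<beta>\<ge>1. sup_deviation a \<beta> (N \<beta>) X T \<in> borel_measurable (M \<beta>)) \<and>
           (\<forall>T>0. \<forall>\<epsilon>>0.
              (\<lambda>\<beta>. measure (M \<beta>) {\<omega> \<in> space (M \<beta>). \<epsilon> \<le> sup_deviation a \<beta> (N \<beta>) X T \<omega>})
                \<longlonglongrightarrow> 0)"
proof -
  interpret flow_network C r lam \<mu> a
    by unfold_locales (fact assms)+
  obtain X where X: "fluid_solution C r lam \<mu> a x0 X"
    using fluid_solution_exists assms(9) by blast
  have "continuous_on {0..} X"
    using X has_vector_derivative_continuous
    unfolding fluid_solution_iff continuous_on_eq_continuous_within by blast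
  then have "sup_deviation a \<beta> (N \<beta>) X T \<in> borel_measurable (M \<beta>)" if "0 < T" "1 \<le> \<beta>" for T \<beta>
    using sup_deviation_measurable[OF assms(7)] that by simp
  moreover have "(\<lambda>\<beta>. measure (M \<beta>) {\<omega> \<in> space (M \<beta>). \<epsilon> \<le> sup_deviation a \<beta> (N \<beta>) X T \<omega>}) \<longlonglongrightarrow> 0"
    if "0 < T" "0 < \<epsilon>" for T \<epsilon>
    by (rule fluid_limit_in_probability[OF assms(7,8,10) X that])
  ultimately show ?thesis
    using X fluid_solution_unique by blast
qed

end
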